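(* Let $q\ge 4$ and let $H_1$ be a hyperplane of $\mathrm{PG}(U_1)$ with $|H_1\cap\mathcal O_1|=q^2-q+1$. Then $H_1\cap\mathcal O_1$ is a $(6,4)$-set of $H_1\cong\mathrm{PG}(6,q)$.
   Context: $q$ is a prime power. Let $U_1\subset\mathbb F_{q^3}^8$ be the set of vectors $(a,b^{q^2},b^{q},c,b,c^{q},c^{q^2},d)$ with $a,d\in\mathbb F_q$, $b,c\in\mathbb F_{q^3}$; it is an $8$-dimensional $\mathbb F_q$-vector space, so $\mathrm{PG}(U_1)\cong\mathrm{PG}(7,q)$. For $(a,b,c,d)\ne 0$ let $P(a,b,c,d)$ be the point of $\mathrm{PG}(U_1)$ spanned by this vector. Let $\mathcal O_1=\{P(1,t,t^{q^2+q},t^{q^2+q+1}) : t\in\mathbb F_{q^3}\}\cup\{P(0,0,0,1)\}$. For integers $r,s$, an $(r,s)$-set of $\mathrm{PG}(n,q)$ is a set $\mathcal X$ of points such that: (i) every $s$-dimensional projective subspace contains at most $r$ points of $\mathcal X$; (ii) $\mathcal X$ spans $\mathrm{PG}(n,q)$; (iii) some $(s+1)$-dimensional projective subspace contains $r+2$ points of $\mathcal X$. *)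

theory Defs
  imports "HOL-Computational_Algebra.Primes"
begin

text \<open>Ambient setting: a finite field 'a of order q^3 (playing F_{q^3});
 vectors of F_{q^3}^8 are functions nat => 'a (only coordinates 0..7 are used,
 the others are 0).  F_q is the subfield {x. x^q = x}.\<close>

definition Fq :: "nat \<Rightarrow> 'a::{finite,field} set" where
  "Fq q = {x. x ^ q = x}"

definition u1vec :: "nat \<Rightarrow> 'a::{finite,field} \<Rightarrow> 'a \<Rightarrow> 'a \<Rightarrow> 'a \<Rightarrow> nat \<Rightarrow> 'a" where
  "u1vec q a b c d = (\<lambda>i. if i = 0 then a else if i = 1 then b ^ (q^2)
     else if i = 2 then b ^ q else if i = 3 then c else if i = 4 then b
     else if i = 5 then c ^ q else if i = 6 then c ^ (q^2) else if i = 7 then d else 0)"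

definition U1 :: "nat \<Rightarrow> (nat \<Rightarrow> 'a::{finite,field}) set" where
  "U1 q = {u1vec q a b c d | a b c d. a \<in> Fq q \<and> d \<in> Fq q}"

definition fq_span :: "nat \<Rightarrow> (nat \<Rightarrow> 'a::{finite,field}) list \<Rightarrow> (nat \<Rightarrow> 'a) set" where
  "fq_span q vs = {(\<lambda>i. \<Sum>j<length vs. cs j * (vs ! j) i) | cs. \<forall>j. cs j \<in> Fq q}"

definition fq_indep :: "nat \<Rightarrow> (nat \<Rightarrow> 'a::{finite,field}) list \<Rightarrow> bool" where
  "fq_indep q vs \<longleftrightarrow> (\<forall>cs. (\<forall>j. cs j \<in> Fq q) \<longrightarrow>
      (\<lambda>i. \<Sum>j<length vs. cs j * (vs ! j) i) = (\<lambda>_. 0) \<longrightarrow> (\<forall>j<length vs. cs j = 0))"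

definition fq_subspace_dim :: "nat \<Rightarrow> (nat \<Rightarrow> 'a::{finite,field}) set \<Rightarrow> nat \<Rightarrow> bool" where
  "fq_subspace_dim q W k \<longleftrightarrow>
     (\<exists>vs. length vs = k \<and> set vs \<subseteq> W \<and> fq_indep q vs \<and> fq_span q vs = W)"

definition Pt :: "nat \<Rightarrow> 'a::{finite,field} \<Rightarrow> 'a \<Rightarrow> 'a \<Rightarrow> 'a \<Rightarrow> (nat \<Rightarrow> 'a) set" where
  "Pt q a b c d = fq_span q [u1vec q a b c d]"

definition O1 :: "nat \<Rightarrow> (nat \<Rightarrow> 'a::{finite,field}) set set" where
  "O1 q = {Pt q 1 t (t ^ (q^2 + q)) (t ^ (q^2 + q + 1)) | t. True} \<union> {Pt q 0 0 0 1}"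

definition pts_in :: "(nat \<Rightarrow> 'a) set set \<Rightarrow> (nat \<Rightarrow> 'a) set \<Rightarrow> (nat \<Rightarrow> 'a) set set" where
  "pts_in X W = {P \<in> X. P \<subseteq> W}"

text \<open>(r,s)-set of the projective space PG(V) (V an F_q-vector space of dimension n+1,
  here given as a subspace of U1; projective s-subspaces = vector subspaces of dimension s+1).\<close>
definition rs_set :: "nat \<Rightarrow> nat \<Rightarrow> nat \<Rightarrow> (nat \<Rightarrow> 'a::{finite,field}) set
     \<Rightarrow> (nat \<Rightarrow> 'a) set set \<Rightarrow> bool" where
  "rs_set q r s V X \<longleftrightarrow>
     (\<forall>W. W \<subseteq> V \<and> fq_subspace_dim q W (s + 1) \<longrightarrow> card (pts_in X W) \<le> r) \<and>
     (\<exists>vs. set vs \<subseteq> \<Union>X \<and> fq_span q vs = V) \<and>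
     (\<exists>W. W \<subseteq> V \<and> fq_subspace_dim q W (s + 2) \<and> card (pts_in X W) \<ge> r + 2)"

end

theory Submission
  imports
    Defs
    "HOL-Algebra.Algebraic_Closure_Type"
    "HOL-Library.FuncSet"
    "HOL-Library.Function_Algebras"
    "HOL-Library.Product_Plus"
begin

hide_const (open) Divisibility.prime

text \<open>
  A hyperplane is the kernel of a functional, whose value at the point with parameter \<open>t\<close> is
  \<open>T(t, t\<^sup>q, t\<^bsup>q\<^sup>2\<^esup>)\<close> for a trilinear form \<open>T\<close>. The Hessian of \<open>T\<close> is a binary quadratic
  form over the field of order \<open>q\<^sup>3\<close>. If it has a rational root, a change of parameter turns the
  functional into \<open>N(t) - c\<close> or \<open>A + Tr(B t)\<close>, and it never has \<open>q\<^sup>2 - q + 1\<close> zeros.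
  Otherwise its two conjugate roots yield a coordinate \<open>z\<close> on the projective line which identifies
  the zeros of the functional with the roots of unity of order \<open>q\<^sup>2 - q + 1\<close>. There
  \<open>z\<^bsup>q\<^sup>2\<^esup> = z\<^sup>q / z\<close>, and every functional takes the form \<open>\<gamma> + Tr(\<beta> z)\<close> up to a factor, where
  \<open>Tr\<close> is the trace from the field of order \<open>q\<^sup>6\<close>. In terms of \<open>u = z\<close> and \<open>v = z\<^sup>q\<close> this is a
  quadratic in \<open>v\<close>; eliminating \<open>v\<close> from two such equations leaves a polynomial of degree 6 in \<open>u\<close>,
  which bounds the points in a subspace. The points span because a single equation has degree
  \<open>2 q + 1 < q\<^sup>2 - q + 1\<close> in \<open>z\<close>. A subspace with eight points is found by counting if \<open>q \<ge> 5\<close>,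
  and explicitly if \<open>q = 4\<close>.
\<close>

(* Keeps the simplifier from turning frob 1 into frob (Suc 0). *)
declare One_nat_def [simp del]

subsection \<open>Counting with fibres\<close>

lemma card_eq_sum_card_fibres:
  assumes "finite A" and "finite B" and "f ` A \<subseteq> B"
  shows "card A = (\<Sum>b\<in>B. card {a \<in> A. f a = b})"
  using sum.group[OF assms, of "\<lambda>_. 1 :: nat"] by simp

lemma card_le_mult_card_if_fibres_le:
  assumes "finite A" and "finite B" and "f ` A \<subseteq> B"
    and "\<And>b. b \<in> B \<Longrightarrow> card {a \<in> A. f a = b} \<le> m"
  shows "card A \<le> m * card B"
  using sum_mono[of B "\<lambda>b. card {a \<in> A. f a = b}" "\<lambda>_. m"] assms(4)
  by (simp add: card_eq_sum_card_fibres[OF assms(1-3)] mult.commute)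

lemma card_fibre_eq_if_fibres_le:
  assumes "finite A" and "finite B" and "f ` A \<subseteq> B"
    and fibre_le: "\<And>b. b \<in> B \<Longrightarrow> card {a \<in> A. f a = b} \<le> m"
    and "m * card B \<le> card A" and "b \<in> B"
  shows "card {a \<in> A. f a = b} = m"
proof (rule ccontr)
  assume "card {a \<in> A. f a = b} \<noteq> m"
  then have "card {a \<in> A. f a = b} < m"
    using fibre_le[OF \<open>b \<in> B\<close>] by simp
  then have "(\<Sum>b\<in>B. card {a \<in> A. f a = b}) < (\<Sum>b\<in>B. m)"
    using fibre_le \<open>b \<in> B\<close> \<open>finite B\<close> by (intro sum_strict_mono_ex1) auto
  then show False
    using assms(5) by (simp add: card_eq_sum_card_fibres[OF assms(1-3)] mult.commute)
qed

lemma card_eq_card_kernel_mult_card_image: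
  fixes f :: "'a::ab_group_add \<Rightarrow> 'b::ab_group_add"
  assumes "finite A"
    and diff_closed: "\<And>a b. a \<in> A \<Longrightarrow> b \<in> A \<Longrightarrow> a - b \<in> A"
    and f_diff: "\<And>a b. a \<in> A \<Longrightarrow> b \<in> A \<Longrightarrow> f (a - b) = f a - f b"
  shows "card A = card {a \<in> A. f a = 0} * card (f ` A)"
proof -
  have fibre: "card {a \<in> A. f a = b} = card {a \<in> A. f a = 0}" if "b \<in> f ` A" for b
  proof -
    obtain a0 where a0: "a0 \<in> A" "f a0 = b"
      using \<open>b \<in> f ` A\<close> by blast
    have add_closed: "a + a0 \<in> A" if "a \<in> A" for a
      using diff_closed[OF that diff_closed[OF diff_closed[OF a0(1) a0(1)] a0(1)]] by simp
    have f_add: "f (a + a0) = f a + b" if "a \<in> A" for a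
      using f_diff[OF add_closed[OF that] a0(1)] a0(2) by simp
    have "bij_betw (\<lambda>a. a - a0) {a \<in> A. f a = b} {a \<in> A. f a = 0}"
      using a0 by (intro bij_betw_byWitness[of _ "\<lambda>a. a + a0"])
        (auto simp: diff_closed f_diff add_closed f_add)
    then show ?thesis
      by (rule bij_betw_same_card)
  qed
  have "card A = (\<Sum>b\<in>f ` A. card {a \<in> A. f a = b})"
    using \<open>finite A\<close> by (intro card_eq_sum_card_fibres) auto
  also have "\<dots> = card {a \<in> A. f a = 0} * card (f ` A)"
    by (simp add: fibre mult.commute)
  finally show ?thesis .
qed

subsection \<open>Roots of polynomials\<close>

lemma
  fixes p :: "'a::idom poly"
  assumes "degree p < n"
  shows finite_power_eq_poly: "finite {x. x ^ n = poly p x}"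
    and card_power_eq_poly: "card {x. x ^ n = poly p x} \<le> n"
proof -
  have degree: "degree (monom 1 n - p) = n"
    using degree_add_eq_left[of "- p" "monom 1 n"] assms by (simp add: degree_monom_eq)
  then have "monom 1 n - p \<noteq> 0"
    using assms by auto
  moreover have "{x. x ^ n = poly p x} = {x. poly (monom 1 n - p) x = 0}"
    by (simp add: poly_monom)
  ultimately show "finite {x. x ^ n = poly p x}" and "card {x. x ^ n = poly p x} \<le> n"
    using poly_roots_finite card_poly_roots_bound degree by metis+
qed

lemma
  fixes c :: "'a::idom"
  assumes "0 < n"
  shows finite_power_eq: "finite {x. x ^ n = c}" and card_power_eq: "card {x. x ^ n = c} \<le> n"
  using finite_power_eq_poly[of "[:c:]" n] card_power_eq_poly[of "[:c:]" n] assms by simp_all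

lemma
  assumes "1 < n"
  shows finite_power_eq_self: "finite {x :: 'a::idom. x ^ n = x}"
    and card_power_eq_self: "card {x :: 'a::idom. x ^ n = x} \<le> n"
  using finite_power_eq_poly[of "[:0, 1 :: 'a:]" n] card_power_eq_poly[of "[:0, 1 :: 'a:]" n] assms
  by simp_all

lemma quadratic_root_cases:
  fixes a b c :: "'a::idom"
  assumes "a \<noteq> 0" and "r \<noteq> s"
    and "a * r\<^sup>2 + b * r + c = 0" and "a * s\<^sup>2 + b * s + c = 0" and "a * t\<^sup>2 + b * t + c = 0"
  shows "t = r \<or> t = s"
proof -
  have "a * (t - r) * (t - s) * (r - s) = (a * t\<^sup>2 + b * t + c) * (r - s)
      - (a * r\<^sup>2 + b * r + c) * (t - s) + (a * s\<^sup>2 + b * s + c) * (t - r)"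
    by (simp add: algebra_simps power2_eq_square)
  then show ?thesis
    using assms by simp
qed

lemma quadratic_common_root_resultant:
  fixes v :: "'a::idom"
  assumes root: "a * v\<^sup>2 + b * v + c = 0" and root': "a' * v\<^sup>2 + b' * v + c' = 0" and "v \<noteq> 0"
  shows "(a * c' - a' * c)\<^sup>2 = (a * b' - a' * b) * (b * c' - b' * c)"
proof -
  define f f' where "f = a * v\<^sup>2 + b * v + c" and "f' = a' * v\<^sup>2 + b' * v + c'"
  have "v\<^sup>2 * ((a * c' - a' * c)\<^sup>2 - (a * b' - a' * b) * (b * c' - b' * c))
      = (a * c' - a' * c) * (c' * f - c * f') - v * (b * c' - b' * c) * (a * f' - a' * f)"
    by (simp add: f_def f'_def algebra_simps power2_eq_square)
  then show ?thesis
    using root root' \<open>v \<noteq> 0\<close> by (simp add: f_def f'_def)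
qed

subsection \<open>Roots of unity\<close>

lemma power_eq_power_mod:
  fixes x :: "'a::monoid_mult"
  assumes "x ^ p = 1"
  shows "x ^ k = x ^ (k mod p)"
proof -
  have "x ^ k = (x ^ p) ^ (k div p) * x ^ (k mod p)"
    by (simp flip: power_mult power_add)
  then show ?thesis
    by (simp add: assms)
qed

lemma power_prime_root_eq_1_iff:
  fixes x :: "'a::monoid_mult"
  assumes "prime p" and "x ^ p = 1" and "x \<noteq> 1"
  shows "x ^ k = 1 \<longleftrightarrow> p dvd k"
proof
  assume "x ^ k = 1"
  show "p dvd k"
  proof (rule ccontr)
    assume "\<not> p dvd k"
    then have "coprime k p"
      using \<open>prime p\<close> coprime_commute prime_imp_coprime by blast
    moreover have "p \<noteq> 1"
      using \<open>prime p\<close> by auto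
    ultimately obtain a b where "k * a = p * b + 1"
      using coprime_bezout_strong by blast
    then have "(x ^ k) ^ a = (x ^ p) ^ b * x"
      by (metis power_add power_mult power_one_right)
    then show False
      using assms(2,3) \<open>x ^ k = 1\<close> by simp
  qed
qed (auto simp: power_mult assms(2))

lemma inj_on_power_prime_root:
  fixes x :: "'a::idom"
  assumes "prime p" and "x ^ p = 1" and "x \<noteq> 1"
  shows "inj_on (\<lambda>k. x ^ k) {..<p}"
proof -
  have "x \<noteq> 0"
    using assms by (auto simp: power_0_left)
  have "i = j" if "i \<le> j" "j < p" "x ^ i = x ^ j" for i j
  proof -
    have "x ^ i * x ^ (j - i) = x ^ i"
      using that by (metis le_add_diff_inverse power_add)
    then have "p dvd j - i"
      using \<open>x \<noteq> 0\<close> power_prime_root_eq_1_iff[OF assms] by simp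
    then show "i = j"
      using that by (auto dest: dvd_imp_le)
  qed
  then show ?thesis
    unfolding inj_on_def by (metis lessThan_iff nle_le)
qed

subsection \<open>The Frobenius map of a finite field\<close>

lemma CHAR_eq_prime_if_card_eq_power:
  assumes "card (UNIV :: 'a::{finite,field} set) = p ^ n" and "prime p"
  shows "CHAR('a) = p"
proof -
  have "prime CHAR('a)"
    by (intro prime_CHAR_semidom finite_imp_CHAR_pos) simp
  moreover have "(\<Sum>x\<in>UNIV. x + 1) = (\<Sum>x\<in>UNIV. x :: 'a)"
    by (intro sum.reindex_bij_witness[of _ "\<lambda>x. x - 1" "\<lambda>x. x + 1"]) auto
  then have "CHAR('a) dvd p ^ n"
    by (simp add: sum.distrib assms(1) of_nat_eq_0_iff_char_dvd flip: of_nat_power)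
  ultimately show ?thesis
    using \<open>prime p\<close> by (metis prime_dvd_power primes_dvd_imp_eq)
qed

text \<open>The library fact \<open>finite_field_power_card_eq_same\<close> does not apply: a type of sort
  \<open>{finite, field}\<close> is not known to be of class \<open>finite_field\<close>.\<close>

lemma power_card_UNIV_eq_self: "x ^ card (UNIV :: 'a set) = x"
  for x :: "'a::{finite,field}"
proof (cases "x = 0")
  case False
  have "(\<Prod>y\<in>UNIV - {0}. x * y) = (\<Prod>y\<in>UNIV - {0}. y)"
    using False by (intro prod.reindex_bij_witness[of _ "\<lambda>y. y / x" "\<lambda>y. x * y"]) auto
  then have "x ^ card (UNIV - {0 :: 'a}) = 1"
    by (simp add: prod.distrib)
  moreover have "card (UNIV :: 'a set) = Suc (card (UNIV - {0 :: 'a}))"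
    by (intro card.remove) auto
  ultimately show ?thesis
    by (simp only: power_Suc mult_1_right)
qed (simp add: card_gt_0_iff)

locale frobenius_field =
  fixes q :: nat and field_type :: "'a::{finite,field} itself"
  assumes q_eq_CHAR_power: "\<exists>k>0. q = CHAR('a) ^ k"
begin

lemma prime_CHAR: "prime CHAR('a)"
  by (intro prime_CHAR_semidom finite_imp_CHAR_pos) simp

lemma q_gt_1: "1 < q"
  using q_eq_CHAR_power prime_gt_1_nat[OF prime_CHAR] by (auto intro: one_less_power)

definition frob :: "nat \<Rightarrow> 'b::monoid_mult \<Rightarrow> 'b" where
  "frob n x = x ^ q ^ n"

lemma power_q_eq_frob: "x ^ q = frob 1 x" and power_q2_eq_frob: "x ^ q\<^sup>2 = frob 2 x"
  by (simp_all add: frob_def)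

lemma frob_at_0 [simp]: "frob 0 x = x"
  and frob_frob [simp]: "frob m (frob n x) = frob (m + n) x"
  and frob_one [simp]: "frob n 1 = 1"
  by (simp_all add: frob_def add.commute[of m] power_add flip: power_mult)

lemma frob_zero [simp]: "frob n (0 :: 'b::semiring_1) = 0"
  using q_gt_1 by (simp add: frob_def power_0_left)

lemma frob_mult: "frob n (x * y) = frob n x * frob n y" for x y :: "'b::comm_monoid_mult"
  by (simp add: frob_def power_mult_distrib)

lemma frob_power: "frob n (x ^ m) = frob n x ^ m"
  by (simp add: frob_def mult.commute flip: power_mult)

lemma frob_divide: "frob n (x / y) = frob n x / frob n y" for x y :: "'b::field"
  by (simp add: frob_def power_divide)

lemma frob_eq_0_iff [simp]: "frob n x = 0 \<longleftrightarrow> x = 0" for x :: "'b::semiring_1_no_zero_divisors"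
  using q_gt_1 by (simp add: frob_def)

lemma frob_add: "frob n (x + y) = frob n x + frob n y"
  if "CHAR('b) = CHAR('a)" for x y :: "'b::comm_ring_1"
proof -
  obtain k where "q = CHAR('a) ^ k"
    using q_eq_CHAR_power by blast
  then have "q ^ n = CHAR('b) ^ (k * n)"
    by (simp add: that power_mult)
  then show ?thesis
    unfolding frob_def using prime_CHAR that by (intro freshmans_dream') simp_all
qed

lemma frob_diff: "frob n (x - y) = frob n x - frob n y"
  if "CHAR('b) = CHAR('a)" for x y :: "'b::comm_ring_1"
  using frob_add[OF that, of n "x - y" y] by simp

lemma frob_uminus: "frob n (- x) = - frob n x"
  if "CHAR('b) = CHAR('a)" for x :: "'b::comm_ring_1"
  using frob_diff[OF that, of n 0 x] by simp

lemma frob_to_ac: "frob n (to_ac x) = to_ac (frob n x)" for x :: 'a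
  by (simp add: frob_def)

lemma frob_eq_iff [simp]: "frob n x = frob n y \<longleftrightarrow> x = y" for x y :: "'a alg_closure"
  using frob_eq_0_iff[of n "x - y"] by (simp add: frob_diff)

lemma frob_surjective:
  fixes x :: "'a alg_closure"
  obtains y where "frob n y = x"
proof -
  have "0 < q ^ n"
    using q_gt_1 by simp
  then obtain y where "y ^ q ^ n = x"
    using nth_root_exists by blast
  then show ?thesis
    using that by (simp add: frob_def)
qed

definition trace6 :: "'a alg_closure \<Rightarrow> 'a alg_closure" where
  "trace6 x = x + frob 1 x + frob 2 x + frob 3 x + frob 4 x + frob 5 x"

lemma trace6_add: "trace6 (x + y) = trace6 x + trace6 y"
  by (simp add: trace6_def frob_add)

lemma trace6_mult_fixed: "frob 1 c = c \<Longrightarrow> trace6 (x * c) = c * trace6 x"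
proof -
  assume c: "frob 1 c = c"
  then have "frob 2 c = c" "frob 3 c = c" "frob 4 c = c" "frob 5 c = c"
    using frob_frob[of 1 1 c] frob_frob[of 1 2 c] frob_frob[of 1 3 c] frob_frob[of 1 4 c]
    by simp_all
  then show ?thesis
    by (simp add: trace6_def frob_mult c algebra_simps)
qed

lemma trace6_frob_1: "frob 6 x = x \<Longrightarrow> trace6 (frob 1 x) = trace6 x"
  and frob_1_trace6: "frob 6 x = x \<Longrightarrow> frob 1 (trace6 x) = trace6 x"
  by (simp_all add: trace6_def frob_add add_ac)

abbreviation Fqa :: "'a set" where "Fqa \<equiv> Fq q"

lemma Fq_iff: "x \<in> Fqa \<longleftrightarrow> frob 1 x = x"
  by (simp add: Fq_def frob_def)

lemma frob_Fq: "x \<in> Fqa \<Longrightarrow> frob n x = x"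
proof (induction n)
  case (Suc n)
  have "frob (Suc n) x = frob 1 (frob n x)"
    by (simp only: frob_frob Suc_eq_plus1_left)
  also have "\<dots> = x"
    using Suc by (simp only: Fq_iff)
  finally show ?case .
qed simp

lemma Fq_0 [simp]: "0 \<in> Fqa" and Fq_1 [simp]: "1 \<in> Fqa"
  by (simp_all add: Fq_iff)

lemma Fq_add: "x \<in> Fqa \<Longrightarrow> y \<in> Fqa \<Longrightarrow> x + y \<in> Fqa"
  and Fq_diff: "x \<in> Fqa \<Longrightarrow> y \<in> Fqa \<Longrightarrow> x - y \<in> Fqa"
  and Fq_uminus: "x \<in> Fqa \<Longrightarrow> - x \<in> Fqa"
  and Fq_mult: "x \<in> Fqa \<Longrightarrow> y \<in> Fqa \<Longrightarrow> x * y \<in> Fqa"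
  and Fq_divide: "x \<in> Fqa \<Longrightarrow> y \<in> Fqa \<Longrightarrow> x / y \<in> Fqa"
  by (simp_all add: Fq_iff frob_add frob_diff frob_uminus frob_mult frob_divide)

lemma card_Fq_gt_1: "1 < card Fqa"
  using card_mono[of Fqa "{0, 1}"] by simp

subsection \<open>Linear algebra over the subfield\<close>

definition fq_subspace :: "(nat \<Rightarrow> 'a) set \<Rightarrow> bool" where
  "fq_subspace W \<longleftrightarrow> (\<lambda>_. 0) \<in> W \<and> (\<forall>u\<in>W. \<forall>v\<in>W. \<forall>c\<in>Fqa. (\<lambda>i. u i + c * v i) \<in> W)"

lemma fq_subspace_zero: "fq_subspace W \<Longrightarrow> (\<lambda>_. 0) \<in> W"
  and fq_subspace_add_scale:
    "fq_subspace W \<Longrightarrow> u \<in> W \<Longrightarrow> v \<in> W \<Longrightarrow> c \<in> Fqa \<Longrightarrow> (\<lambda>i. u i + c * v i) \<in> W"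
  by (simp_all add: fq_subspace_def)

lemma fq_subspace_scale: "fq_subspace W \<Longrightarrow> v \<in> W \<Longrightarrow> c \<in> Fqa \<Longrightarrow> (\<lambda>i. c * v i) \<in> W"
  using fq_subspace_add_scale[of W "\<lambda>_. 0" v c] by (simp add: fq_subspace_zero)

lemma fq_subspace_diff: "fq_subspace W \<Longrightarrow> u \<in> W \<Longrightarrow> v \<in> W \<Longrightarrow> u - v \<in> W"
  using fq_subspace_add_scale[of W u v "- 1"] by (simp add: Fq_uminus fun_diff_def)

lemma fq_subspace_Int: "fq_subspace V \<Longrightarrow> fq_subspace W \<Longrightarrow> fq_subspace (V \<inter> W)"
  by (simp add: fq_subspace_def)

definition lincomb :: "(nat \<Rightarrow> 'a) list \<Rightarrow> (nat \<Rightarrow> 'a) \<Rightarrow> nat \<Rightarrow> 'a" where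
  "lincomb vs cs = (\<lambda>i. \<Sum>j<length vs. cs j * (vs ! j) i)"

lemma fq_span_eq_lincomb: "fq_span q vs = {lincomb vs cs | cs. \<forall>j. cs j \<in> Fqa}"
  by (simp add: fq_span_def lincomb_def)

lemma lincomb_in_span: "(\<And>j. cs j \<in> Fqa) \<Longrightarrow> lincomb vs cs \<in> fq_span q vs"
  by (auto simp: fq_span_eq_lincomb)

lemma fq_indepD:
  assumes "fq_indep q vs" and "\<forall>j. cs j \<in> Fqa" and "lincomb vs cs = (\<lambda>_. 0)" and "j < length vs"
  shows "cs j = 0"
  using assms unfolding fq_indep_def lincomb_def by blast

lemma lincomb_cong: "(\<And>j. j < length vs \<Longrightarrow> cs j = ds j) \<Longrightarrow> lincomb vs cs = lincomb vs ds"
  by (simp add: lincomb_def)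

lemma lincomb_add_scale:
  "lincomb vs (\<lambda>j. cs j + c * ds j) = (\<lambda>i. lincomb vs cs i + c * lincomb vs ds i)"
  by (simp add: lincomb_def sum.distrib sum_distrib_left algebra_simps)

lemma lincomb_snoc: "lincomb (vs @ [v]) cs = (\<lambda>i. lincomb vs cs i + cs (length vs) * v i)"
  by (simp add: lincomb_def nth_append)

lemma fq_subspace_span: "fq_subspace (fq_span q vs)" for vs :: "(nat \<Rightarrow> 'a) list"
  unfolding fq_subspace_def
proof (intro conjI ballI)
  show "(\<lambda>_. 0) \<in> fq_span q vs"
    using lincomb_in_span[of "\<lambda>_. 0" vs] by (simp add: lincomb_def)
next
  fix u v c assume "u \<in> fq_span q vs" "v \<in> fq_span q vs" "c \<in> Fqa"
  then obtain cs ds where "\<forall>j. cs j \<in> Fqa" "\<forall>j. ds j \<in> Fqa" "u = lincomb vs cs" "v = lincomb vs ds"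
    unfolding fq_span_eq_lincomb by blast
  then show "(\<lambda>i. u i + c * v i) \<in> fq_span q vs"
    using \<open>c \<in> Fqa\<close> lincomb_in_span[of "\<lambda>j. cs j + c * ds j" vs]
    by (simp add: lincomb_add_scale Fq_add Fq_mult)
qed

lemma fq_span_superset: "set vs \<subseteq> fq_span q vs" for vs :: "(nat \<Rightarrow> 'a) list"
proof
  fix v assume "v \<in> set vs"
  then obtain k where k: "k < length vs" "v = vs ! k"
    by (auto simp: in_set_conv_nth)
  then have "v = lincomb vs (\<lambda>j. if j = k then 1 else 0)"
    by (simp add: lincomb_def if_distrib[of "\<lambda>c. c * _"] cong: if_cong)
  then show "v \<in> fq_span q vs"
    using lincomb_in_span[of "\<lambda>j. if j = k then 1 else 0" vs] by simp
qed

lemma fq_span_subset: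
  assumes W: "fq_subspace W" and "set vs \<subseteq> W"
  shows "fq_span q vs \<subseteq> W"
proof -
  have "lincomb vs cs \<in> W" if "\<forall>j. cs j \<in> Fqa" for cs
    using \<open>set vs \<subseteq> W\<close>
  proof (induction vs rule: rev_induct)
    case Nil
    then show ?case
      using fq_subspace_zero[OF W] by (simp add: lincomb_def)
  next
    case (snoc v vs)
    then show ?case
      using that by (simp add: lincomb_snoc fq_subspace_add_scale[OF W])
  qed
  then show ?thesis
    by (auto simp: fq_span_eq_lincomb)
qed

lemma fq_span_single: "fq_span q [v] = {(\<lambda>i. c * v i) | c. c \<in> Fqa}" for v :: "nat \<Rightarrow> 'a"
proof
  show "fq_span q [v] \<subseteq> {(\<lambda>i. c * v i) | c. c \<in> Fqa}"
    by (auto simp: fq_span_eq_lincomb lincomb_def)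
  show "{(\<lambda>i. c * v i) | c. c \<in> Fqa} \<subseteq> fq_span q [v]"
    using fq_subspace_scale[OF fq_subspace_span] fq_span_superset[of "[v]"] by auto
qed

lemma fq_indep_snoc:
  fixes vs :: "(nat \<Rightarrow> 'a) list"
  assumes indep: "fq_indep q vs" and notin: "v \<notin> fq_span q vs"
  shows "fq_indep q (vs @ [v])"
  unfolding fq_indep_def lincomb_def[symmetric]
proof (intro allI impI)
  fix cs j assume cs: "\<forall>j. cs j \<in> Fqa" and j: "j < length (vs @ [v])"
    and "lincomb (vs @ [v]) cs = (\<lambda>_. 0)"
  then have sum_0: "lincomb vs cs i + cs (length vs) * v i = 0" for i
    by (metis lincomb_snoc)
  have last: "cs (length vs) = 0"
  proof (rule ccontr)
    assume "cs (length vs) \<noteq> 0"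
    moreover have "lincomb vs cs i = - (cs (length vs) * v i)" for i
      using sum_0[of i] by (simp add: eq_neg_iff_add_eq_0)
    ultimately have "v = (\<lambda>i. - 1 / cs (length vs) * lincomb vs cs i)"
      by simp
    also have "\<dots> \<in> fq_span q vs"
      using cs
      by (intro fq_subspace_scale fq_subspace_span lincomb_in_span Fq_divide Fq_uminus) auto
    finally show False
      using notin by contradiction
  qed
  then have "lincomb vs cs = (\<lambda>_. 0)"
    using sum_0 by (simp add: fun_eq_iff)
  then show "cs j = 0"
    using fq_indepD[OF indep cs] last j by (cases "j = length vs") auto
qed

lemma inj_on_lincomb:
  assumes indep: "fq_indep q vs"
  shows "inj_on (lincomb vs) ({..<length vs} \<rightarrow>\<^sub>E Fqa)"
proof (rule inj_onI)
  fix cs ds assume cs: "cs \<in> {..<length vs} \<rightarrow>\<^sub>E Fqa" and ds: "ds \<in> {..<length vs} \<rightarrow>\<^sub>E Fqa"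
    and eq: "lincomb vs cs = lincomb vs ds"
  define es where "es j = (if j < length vs then cs j - ds j else 0)" for j
  have "lincomb vs es = lincomb vs (\<lambda>j. cs j + (- 1) * ds j)"
    by (rule lincomb_cong) (simp add: es_def)
  also have "\<dots> = (\<lambda>_. 0)"
    unfolding lincomb_add_scale by (simp add: eq)
  finally have "lincomb vs es = (\<lambda>_. 0)" .
  moreover have "\<forall>j. es j \<in> Fqa"
    using cs ds by (auto simp: es_def intro!: Fq_diff)
  ultimately have "cs j = ds j" if "j < length vs" for j
    using fq_indepD[OF indep _ _ that, of es] that by (simp add: es_def)
  then show "cs = ds"
    using cs ds by (intro PiE_ext) auto
qed

lemma fq_span_eq_image_lincomb: "fq_span q vs = lincomb vs ` ({..<length vs} \<rightarrow>\<^sub>E Fqa)"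
proof (intro subset_antisym subsetI)
  fix v assume "v \<in> fq_span q vs"
  then obtain cs where cs: "\<forall>j. cs j \<in> Fqa" "v = lincomb vs cs"
    by (auto simp: fq_span_eq_lincomb)
  have "lincomb vs cs = lincomb vs (restrict cs {..<length vs})"
    by (rule lincomb_cong) simp
  then show "v \<in> lincomb vs ` ({..<length vs} \<rightarrow>\<^sub>E Fqa)"
    using cs by auto
next
  fix v assume "v \<in> lincomb vs ` ({..<length vs} \<rightarrow>\<^sub>E Fqa)"
  then obtain cs where cs: "cs \<in> {..<length vs} \<rightarrow>\<^sub>E Fqa" "v = lincomb vs cs"
    by blast
  have "lincomb vs cs = lincomb vs (\<lambda>j. if j < length vs then cs j else 0)"
    by (rule lincomb_cong) simp
  then show "v \<in> fq_span q vs"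
    using cs lincomb_in_span[of "\<lambda>j. if j < length vs then cs j else 0" vs]
    by (auto simp: PiE_iff)
qed

lemma
  fixes vs :: "(nat \<Rightarrow> 'a) list"
  assumes "fq_indep q vs"
  shows finite_fq_span: "finite (fq_span q vs)"
    and card_fq_span: "card (fq_span q vs) = card Fqa ^ length vs"
  using inj_on_lincomb[OF assms]
  by (simp_all add: fq_span_eq_image_lincomb finite_PiE card_image card_funcsetE)

lemma fq_basis_exists:
  fixes S :: "(nat \<Rightarrow> 'a) set"
  assumes "finite S"
  obtains vs where "set vs \<subseteq> S" "fq_indep q vs" "S \<subseteq> fq_span q vs"
proof -
  have "\<exists>vs. set vs \<subseteq> S \<and> fq_indep q vs \<and> S \<subseteq> fq_span q vs"
    using assms
  proof (induction S rule: finite_induct)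
    case empty
    show ?case
      by (intro exI[of _ "[]"]) (simp add: fq_indep_def)
  next
    case (insert v S)
    then obtain vs where vs: "set vs \<subseteq> S" "fq_indep q vs" "S \<subseteq> fq_span q vs"
      by blast
    show ?case
    proof (cases "v \<in> fq_span q vs")
      case True
      then show ?thesis
        using vs by blast
    next
      case False
      have "set vs \<union> {v} \<subseteq> fq_span q (vs @ [v])"
        using fq_span_superset[of "vs @ [v]"] by simp
      then have "insert v S \<subseteq> fq_span q (vs @ [v])"
        using vs(3) fq_span_subset[OF fq_subspace_span, of vs "vs @ [v]"] by blast
      then show ?thesis
        using vs fq_indep_snoc[OF vs(2) False] by (intro exI[of _ "vs @ [v]"]) auto
    qed
  qed
  then show ?thesis
    using that by blast
qed

lemma fq_subspace_dim_iff:
  "fq_subspace_dim q W k \<longleftrightarrow> fq_subspace W \<and> finite W \<and> card W = card Fqa ^ k"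
proof
  assume "fq_subspace_dim q W k"
  then show "fq_subspace W \<and> finite W \<and> card W = card Fqa ^ k"
    using fq_subspace_span finite_fq_span card_fq_span unfolding fq_subspace_dim_def by blast
next
  assume W: "fq_subspace W \<and> finite W \<and> card W = card Fqa ^ k"
  then obtain vs where vs: "set vs \<subseteq> W" "fq_indep q vs" "W \<subseteq> fq_span q vs"
    using fq_basis_exists by blast
  then have span: "fq_span q vs = W"
    using fq_span_subset W by blast
  then have "card Fqa ^ length vs = card Fqa ^ k"
    using card_fq_span[OF vs(2)] W by simp
  then have "length vs = k"
    using card_Fq_gt_1 by (simp add: power_inject_exp)
  then show "fq_subspace_dim q W k"
    using vs span unfolding fq_subspace_dim_def by blast
qed

end

subsection \<open>Trace and norm of the cubic extension\<close>

locale cubic_extension = frobenius_field q field_type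
  for q :: nat and field_type :: "'a::{finite,field} itself" +
  assumes card_UNIV: "card (UNIV :: 'a set) = q ^ 3"

lemma cubic_extension_if_prime_power:
  assumes "\<exists>p k. prime p \<and> k > 0 \<and> q = p ^ k" and "card (UNIV :: 'a::{finite,field} set) = q ^ 3"
  shows "cubic_extension TYPE('a) q"
proof
  obtain p k where pk: "prime p" "k > 0" "q = p ^ k"
    using assms(1) by blast
  then have "CHAR('a) = p"
    using assms(2) CHAR_eq_prime_if_card_eq_power[of p "k * 3"] by (simp add: power_mult)
  then show "\<exists>k>0. q = CHAR('a) ^ k"
    using pk by blast
qed fact

context cubic_extension
begin

lemma frob_3 [simp]: "frob 3 x = x" for x :: 'a
  using power_card_UNIV_eq_self[of x] by (simp add: frob_def card_UNIV)

lemma frob_4 [simp]: "frob 4 x = frob 1 x" for x :: 'a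
  using frob_frob[of 1 3 x] by simp

lemma frob_5 [simp]: "frob 5 x = frob 2 x" for x :: 'a
  using frob_frob[of 2 3 x] by simp

definition rel_trace :: "'a \<Rightarrow> 'a" where "rel_trace x = x + frob 1 x + frob 2 x"

definition rel_norm :: "'a \<Rightarrow> 'a" where "rel_norm x = x * frob 1 x * frob 2 x"

lemma rel_trace_in_Fq: "rel_trace x \<in> Fqa"
  by (simp add: Fq_iff rel_trace_def frob_add)

lemma rel_norm_in_Fq: "rel_norm x \<in> Fqa"
  by (simp add: Fq_iff rel_norm_def frob_mult mult_ac)

lemma rel_norm_eq_power: "rel_norm x = x ^ (q\<^sup>2 + q + 1)"
  by (simp add: rel_norm_def frob_def power_add mult_ac)

lemma rel_norm_eq_0_iff [simp]: "rel_norm x = 0 \<longleftrightarrow> x = 0"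
  by (simp add: rel_norm_def)

lemma card_nonzero: "card (UNIV - {0 :: 'a}) = (q\<^sup>2 + q + 1) * (q - 1)"
proof -
  obtain m where "q = Suc m"
    using q_gt_1 by (cases q) auto
  then show ?thesis
    by (simp add: card_Diff_subset card_UNIV power2_eq_square power3_eq_cube algebra_simps)
qed

lemma card_rel_norm_fibre_le: "card {x \<in> UNIV - {0}. rel_norm x = n} \<le> q\<^sup>2 + q + 1"
proof -
  have "card {x \<in> UNIV - {0}. rel_norm x = n} \<le> card {x. x ^ (q\<^sup>2 + q + 1) = n}"
    by (intro card_mono) (auto simp: rel_norm_eq_power)
  also have "\<dots> \<le> q\<^sup>2 + q + 1"
    by (rule card_power_eq) simp
  finally show ?thesis .
qed

lemma card_Fq: "card Fqa = q"
proof (rule antisym)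
  show "card Fqa \<le> q"
    unfolding Fq_def using q_gt_1 by (rule card_power_eq_self)
  have "card (UNIV - {0 :: 'a}) \<le> (q\<^sup>2 + q + 1) * card (Fqa - {0})"
    using card_rel_norm_fibre_le rel_norm_in_Fq
    by (intro card_le_mult_card_if_fibres_le[of _ _ rel_norm]) auto
  then have "q - 1 \<le> card Fqa - 1"
    unfolding card_nonzero by (simp only: mult_le_cancel1 card_Diff_singleton Fq_0)
  then show "q \<le> card Fqa"
    using card_Fq_gt_1 by linarith
qed

lemma card_rel_norm_fibre:
  assumes "n \<in> Fqa" and "n \<noteq> 0"
  shows "card {x. rel_norm x = n} = q\<^sup>2 + q + 1"
proof -
  have "card {x \<in> UNIV - {0}. rel_norm x = n} = q\<^sup>2 + q + 1"
  proof (rule card_fibre_eq_if_fibres_le[where B = "Fqa - {0}"])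
    show "(q\<^sup>2 + q + 1) * card (Fqa - {0}) \<le> card (UNIV - {0 :: 'a})"
      unfolding card_nonzero by (simp add: card_Fq)
  qed (use assms card_rel_norm_fibre_le rel_norm_in_Fq in auto)
  also have "{x \<in> UNIV - {0}. rel_norm x = n} = {x. rel_norm x = n}"
    using \<open>n \<noteq> 0\<close> by auto
  finally show ?thesis .
qed

lemma card_rel_trace_fibre_le: "card {x. rel_trace x = a} \<le> q\<^sup>2"
proof -
  define p where "p = [:a:] - monom 1 1 - monom 1 q"
  have "q < q\<^sup>2"
    using q_gt_1 by (simp add: power2_eq_square)
  then have "degree p < q\<^sup>2"
    unfolding p_def using q_gt_1 by (intro degree_diff_less) (simp_all add: degree_monom_eq)
  moreover have "{x. rel_trace x = a} = {x. x ^ q\<^sup>2 = poly p x}"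
    by (auto simp: rel_trace_def frob_def p_def poly_monom algebra_simps)
  ultimately show ?thesis
    using card_power_eq_poly by metis
qed

lemma card_rel_trace_fibre:
  assumes "a \<in> Fqa"
  shows "card {x. rel_trace x = a} = q\<^sup>2"
proof -
  have "card {x \<in> UNIV. rel_trace x = a} = q\<^sup>2"
    using assms card_rel_trace_fibre_le rel_trace_in_Fq
    by (intro card_fibre_eq_if_fibres_le[where B = Fqa])
      (auto simp: card_UNIV card_Fq power2_eq_square power3_eq_cube)
  then show ?thesis
    by simp
qed

end

subsection \<open>Functionals and hyperplanes\<close>

text \<open>The tuple \<open>(A, B, C, D)\<close> stands for the functional
  \<open>(a, b, c, d) \<mapsto> A a + Tr (B b) + Tr (C c) + D d\<close> on \<open>U1\<close>.\<close>

type_synonym 'a covector = "'a \<times> 'a \<times> 'a \<times> 'a"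

fun scale_covector :: "'a::times \<Rightarrow> 'a covector \<Rightarrow> 'a covector" where
  "scale_covector l (A, B, C, D) = (l * A, l * B, l * C, l * D)"

context cubic_extension
begin

definition dual :: "'a covector set" where "dual = Fqa \<times> UNIV \<times> UNIV \<times> Fqa"

fun functional :: "'a covector \<Rightarrow> (nat \<Rightarrow> 'a) \<Rightarrow> 'a" where
  "functional (A, B, C, D) v = A * v 0 + frob 2 B * v 1 + frob 1 B * v 2 + C * v 3
     + B * v 4 + frob 1 C * v 5 + frob 2 C * v 6 + D * v 7"

lemma functional_add_scale: "functional g (\<lambda>i. u i + c * v i) = functional g u + c * functional g v"
  by (cases g) (simp add: algebra_simps)

lemma functional_zero: "functional g (\<lambda>_. 0) = 0"
  by (cases g) simp

lemma functional_diff_right: "functional g (u - v) = functional g u - functional g v"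
  by (cases g) (simp add: algebra_simps)

lemma functional_diff_left: "functional (g - h) v = functional g v - functional h v"
  by (cases g; cases h) (simp add: frob_diff algebra_simps)

lemma functional_scale_left: "l \<in> Fqa \<Longrightarrow> functional (scale_covector l g) v = l * functional g v"
  by (cases g) (simp add: frob_Fq frob_mult algebra_simps)

lemma dual_diff: "g \<in> dual \<Longrightarrow> h \<in> dual \<Longrightarrow> g - h \<in> dual"
  and dual_scale: "l \<in> Fqa \<Longrightarrow> g \<in> dual \<Longrightarrow> scale_covector l g \<in> dual"
  by (auto simp: dual_def Fq_diff Fq_mult)

lemma card_dual: "card dual = q ^ 8"
proof -
  have "card dual = q * (q ^ 3 * (q ^ 3 * q))"
    unfolding dual_def by (simp only: card_cartesian_product card_Fq card_UNIV)
  also have "\<dots> = q ^ (1 + (3 + (3 + 1)))"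
    by (simp only: power_add power_one_right)
  finally show ?thesis
    by simp
qed

lemma functional_u1vec:
  "functional (A, B, C, D) (u1vec q a b c d)
    = A * a + rel_trace (B * b) + rel_trace (C * c) + D * d"
  by (simp add: u1vec_def rel_trace_def frob_mult power_q_eq_frob power_q2_eq_frob)

declare functional.simps [simp del]

lemma functional_in_Fq: "g \<in> dual \<Longrightarrow> v \<in> U1 q \<Longrightarrow> functional g v \<in> Fqa"
  by (cases g) (auto simp: dual_def U1_def functional_u1vec intro!: Fq_add Fq_mult rel_trace_in_Fq)

lemma fq_subspace_U1: "fq_subspace (U1 q)"
  unfolding fq_subspace_def
proof (intro conjI ballI)
  have "(\<lambda>_. 0) = u1vec q 0 0 0 (0 :: 'a)"
    by (auto simp: u1vec_def power_q_eq_frob power_q2_eq_frob)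
  then show "(\<lambda>_. 0 :: 'a) \<in> U1 q"
    unfolding U1_def using Fq_0 by blast
next
  fix u v :: "nat \<Rightarrow> 'a" and l
  assume "u \<in> U1 q" "v \<in> U1 q" and l: "l \<in> Fqa"
  then obtain a b c d a' b' c' d' where uv: "u = u1vec q a b c d" "v = u1vec q a' b' c' d'"
    and "a \<in> Fqa" "d \<in> Fqa" "a' \<in> Fqa" "d' \<in> Fqa"
    unfolding U1_def by blast
  then have "a + l * a' \<in> Fqa" "d + l * d' \<in> Fqa"
    using l by (auto intro: Fq_add Fq_mult)
  moreover have "(\<lambda>i. u i + l * v i) = u1vec q (a + l * a') (b + l * b') (c + l * c') (d + l * d')"
    using l by (auto simp: uv u1vec_def power_q_eq_frob power_q2_eq_frob frob_add frob_mult frob_Fq)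
  ultimately show "(\<lambda>i. u i + l * v i) \<in> U1 q"
    unfolding U1_def by blast
qed

lemma finite_U1: "finite (U1 q :: (nat \<Rightarrow> 'a) set)"
  and card_U1_le: "card (U1 q :: (nat \<Rightarrow> 'a) set) \<le> q ^ 8"
proof -
  have U1: "U1 q = (\<lambda>(a, b, c, d). u1vec q a b c d) ` dual"
    by (auto simp: U1_def dual_def image_def)
  show "finite (U1 q :: (nat \<Rightarrow> 'a) set)" and "card (U1 q :: (nat \<Rightarrow> 'a) set) \<le> q ^ 8"
    unfolding U1 using card_image_le[of dual] card_dual by auto
qed

definition annihilator :: "(nat \<Rightarrow> 'a) set \<Rightarrow> 'a covector set" where
  "annihilator S = {g \<in> dual. \<forall>v\<in>S. functional g v = 0}"

lemma annihilator_subset_dual: "annihilator S \<subseteq> dual"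
  by (auto simp: annihilator_def)

lemma card_annihilator_le_mult_q:
  assumes "v \<in> U1 q"
  shows "card (annihilator S) \<le> card (annihilator (insert v S)) * q"
proof -
  let ?f = "\<lambda>g. functional g v"
  have "card (annihilator S) = card {g \<in> annihilator S. ?f g = 0} * card (?f ` annihilator S)"
    by (rule card_eq_card_kernel_mult_card_image)
      (auto simp: annihilator_def functional_diff_left dual_diff)
  also have "{g \<in> annihilator S. ?f g = 0} = annihilator (insert v S)"
    by (auto simp: annihilator_def)
  also have "card (?f ` annihilator S) \<le> card Fqa"
    using assms by (intro card_mono) (auto simp: annihilator_def intro: functional_in_Fq)
  finally show ?thesis
    by (simp add: card_Fq)
qed

lemma card_annihilator_ge:
  assumes "set vs \<subseteq> U1 q" and "length vs \<le> n" and "n \<le> 8"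
  shows "q ^ (8 - n) \<le> card (annihilator (set vs))"
proof -
  have "q ^ 8 \<le> card (annihilator (set vs)) * q ^ length vs"
    using assms(1)
  proof (induction vs)
    case Nil
    then show ?case
      by (simp add: annihilator_def card_dual)
  next
    case (Cons v vs)
    then have "q ^ 8 \<le> card (annihilator (set vs)) * q ^ length vs"
      by simp
    also have "\<dots> \<le> (card (annihilator (set (v # vs))) * q) * q ^ length vs"
      using card_annihilator_le_mult_q[of v "set vs"] Cons.prems by (intro mult_right_mono) auto
    finally show ?case
      by (simp add: mult.assoc)
  qed
  also have "\<dots> \<le> card (annihilator (set vs)) * q ^ n"
    using assms(2) q_gt_1 by (intro mult_left_mono power_increasing) auto
  also have "q ^ 8 = q ^ (8 - n) * q ^ n"
    using \<open>n \<le> 8\<close> by (simp flip: power_add)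
  finally show ?thesis
    using q_gt_1 by simp
qed

lemma annihilator_fq_span: "annihilator (fq_span q vs) = annihilator (set vs)"
proof
  show "annihilator (fq_span q vs) \<subseteq> annihilator (set vs)"
    using fq_span_superset unfolding annihilator_def by blast
  have "fq_span q vs \<subseteq> {v. functional g v = 0}" if "g \<in> annihilator (set vs)" for g
    using that by (intro fq_span_subset)
      (auto simp: fq_subspace_def annihilator_def functional_add_scale functional_zero)
  then show "annihilator (set vs) \<subseteq> annihilator (fq_span q vs)"
    unfolding annihilator_def by blast
qed

lemma card_annihilator_subspace:
  assumes "W \<subseteq> U1 q" and "fq_subspace_dim q W n" and "n \<le> 8"
  shows "q ^ (8 - n) \<le> card (annihilator W)"
proof -
  obtain vs where "length vs = n" "set vs \<subseteq> W" "fq_span q vs = W"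
    using assms(2) unfolding fq_subspace_dim_def by blast
  then show ?thesis
    using card_annihilator_ge[of vs n] annihilator_fq_span[of vs] assms by auto
qed

definition hyperplane :: "'a covector \<Rightarrow> (nat \<Rightarrow> 'a) set" where
  "hyperplane g = {u \<in> U1 q. functional g u = 0}"

lemma fq_subspace_hyperplane: "fq_subspace (hyperplane g)"
  using fq_subspace_U1
  by (auto simp: hyperplane_def fq_subspace_def functional_add_scale functional_zero)

lemma hyperplane_subset_U1: "hyperplane g \<subseteq> U1 q"
  by (auto simp: hyperplane_def)

lemma card_Int_hyperplane:
  assumes W: "fq_subspace W" "W \<subseteq> U1 q" and g: "g \<in> dual" and "\<not> W \<subseteq> hyperplane g"
  shows "card W = card (W \<inter> hyperplane g) * q"
proof -
  obtain v where v: "v \<in> W" "functional g v \<noteq> 0"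
    using \<open>\<not> W \<subseteq> hyperplane g\<close> W(2) by (auto simp: hyperplane_def)
  have "functional g ` W = Fqa"
  proof (intro subset_antisym subsetI)
    show "c \<in> Fqa" if "c \<in> functional g ` W" for c
      using that W(2) g by (auto intro: functional_in_Fq)
    fix c assume "c \<in> Fqa"
    then have "(\<lambda>i. c / functional g v * v i) \<in> W"
      using v W g by (intro fq_subspace_scale Fq_divide functional_in_Fq) auto
    moreover have "functional g (\<lambda>i. c / functional g v * v i) = c"
      using functional_add_scale[of g "\<lambda>_. 0" "c / functional g v" v] v
      by (simp add: functional_zero)
    ultimately show "c \<in> functional g ` W"
      by (metis imageI)
  qed
  moreover have "{u \<in> W. functional g u = 0} = W \<inter> hyperplane g"
    using W(2) by (auto simp: hyperplane_def)
  moreover have "card W = card {u \<in> W. functional g u = 0} * card (functional g ` W)"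
    using finite_subset[OF W(2) finite_U1]
    by (rule card_eq_card_kernel_mult_card_image)
      (auto simp: functional_diff_right intro: fq_subspace_diff[OF W(1)])
  ultimately show ?thesis
    by (simp add: card_Fq)
qed

subsection \<open>The point set \<open>O1\<close>\<close>

text \<open>The points of \<open>O1\<close> are parametrised by the projective line over the field of order \<open>q\<^sup>3\<close>,
  with \<open>None\<close> as the point at infinity.\<close>

fun ovoid_vec :: "'a option \<Rightarrow> nat \<Rightarrow> 'a" where
  "ovoid_vec None = u1vec q 0 0 0 1"
| "ovoid_vec (Some t) = u1vec q 1 t (t ^ (q\<^sup>2 + q)) (t ^ (q\<^sup>2 + q + 1))"

definition ovoid_point :: "'a option \<Rightarrow> (nat \<Rightarrow> 'a) set" where
  "ovoid_point P = fq_span q [ovoid_vec P]"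

definition val_at :: "'a covector \<Rightarrow> 'a option \<Rightarrow> 'a" where
  "val_at g P = functional g (ovoid_vec P)"

definition zeros :: "'a covector \<Rightarrow> 'a option set" where
  "zeros g = {P. val_at g P = 0}"

lemma val_at_None: "val_at (A, B, C, D) None = D"
  by (simp add: val_at_def functional_u1vec rel_trace_def)

lemma val_at_Some:
  "val_at (A, B, C, D) (Some t)
    = A + rel_trace (B * t) + rel_trace (C * frob 1 t * frob 2 t) + D * rel_norm t"
proof -
  have "t ^ (q\<^sup>2 + q) = frob 1 t * frob 2 t"
    by (simp add: frob_def power_add)
  then show ?thesis
    by (simp add: val_at_def functional_u1vec mult_ac flip: rel_norm_eq_power)
qed

lemma val_at_Some_expand:
  "val_at (A, B, C, D) (Some t) = A + B * t + frob 1 B * frob 1 t + frob 2 B * frob 2 t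
    + C * frob 1 t * frob 2 t + frob 1 C * frob 2 t * t + frob 2 C * t * frob 1 t
    + D * t * frob 1 t * frob 2 t"
  by (simp add: val_at_Some rel_trace_def rel_norm_def frob_mult algebra_simps)

lemma ovoid_vec_in_U1: "ovoid_vec P \<in> U1 q"
proof (cases P)
  case None
  then show ?thesis
    unfolding U1_def None ovoid_vec.simps using Fq_0 Fq_1 by blast
next
  case (Some t)
  then show ?thesis
    unfolding U1_def Some ovoid_vec.simps
    using Fq_1 rel_norm_in_Fq[of t, unfolded rel_norm_eq_power] by blast
qed

lemma val_at_in_Fq: "g \<in> dual \<Longrightarrow> val_at g P \<in> Fqa"
  unfolding val_at_def by (rule functional_in_Fq[OF _ ovoid_vec_in_U1])

lemma val_at_diff: "val_at (g - h) P = val_at g P - val_at h P"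
  and val_at_scale: "l \<in> Fqa \<Longrightarrow> val_at (scale_covector l g) P = l * val_at g P"
  by (simp_all add: val_at_def functional_diff_left functional_scale_left)

lemma ovoid_vec_in_hyperplane_iff: "ovoid_vec P \<in> hyperplane g \<longleftrightarrow> P \<in> zeros g"
  using ovoid_vec_in_U1 by (auto simp: hyperplane_def zeros_def val_at_def)

lemma in_zeros_if_annihilator: "g \<in> annihilator S \<Longrightarrow> ovoid_vec P \<in> S \<Longrightarrow> P \<in> zeros g"
  by (simp add: annihilator_def zeros_def val_at_def)

lemma O1_eq_range_ovoid_point: "O1 q = range ovoid_point"
proof -
  have "range ovoid_point = insert (ovoid_point None) (ovoid_point ` range Some)"
    by (metis UNIV_option_conv image_insert)
  moreover have "ovoid_point ` range Some = {Pt q 1 t (t ^ (q\<^sup>2 + q)) (t ^ (q\<^sup>2 + q + 1)) | t. True}"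
    unfolding Pt_def ovoid_point_def image_image ovoid_vec.simps by blast
  ultimately show ?thesis
    by (simp add: O1_def Pt_def ovoid_point_def)
qed

lemma ovoid_vec_in_ovoid_point: "ovoid_vec P \<in> ovoid_point P"
  using fq_span_superset[of "[ovoid_vec P]"] by (simp add: ovoid_point_def)

lemma inj_ovoid_point: "inj ovoid_point"
proof (rule injI)
  fix P Q assume "ovoid_point P = ovoid_point Q"
  then obtain c where c: "ovoid_vec P = (\<lambda>i. c * ovoid_vec Q i)"
    using ovoid_vec_in_ovoid_point[of P] by (auto simp: ovoid_point_def fq_span_single)
  show "P = Q"
    using fun_cong[OF c, of 0] fun_cong[OF c, of 4] fun_cong[OF c, of 7]
    by (cases P; cases Q) (auto simp: u1vec_def)
qed

lemma ovoid_point_subset_iff: "fq_subspace W \<Longrightarrow> ovoid_point P \<subseteq> W \<longleftrightarrow> ovoid_vec P \<in> W"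
  using fq_span_subset[of W "[ovoid_vec P]"] ovoid_vec_in_ovoid_point[of P]
  by (auto simp: ovoid_point_def)

lemma pts_in_O1: "fq_subspace W \<Longrightarrow> pts_in (O1 q) W = ovoid_point ` {P. ovoid_vec P \<in> W}"
  using ovoid_point_subset_iff[of W] by (auto simp only: pts_in_def O1_eq_range_ovoid_point)

lemma card_pts_in_O1: "fq_subspace W \<Longrightarrow> card (pts_in (O1 q) W) = card {P. ovoid_vec P \<in> W}"
  by (simp add: pts_in_O1 card_image inj_on_subset[OF inj_ovoid_point])

lemma covector_eq_0_if_val_at_eq_0:
  assumes "\<And>P. val_at g P = 0"
  shows "g = 0"
proof -
  obtain A B C D where g: "g = (A, B, C, D)"
    by (cases g)
  define p where "p = monom A 0 + monom B 1 + monom (frob 1 B) q + monom (frob 2 B) (q\<^sup>2)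
    + monom C (q + q\<^sup>2) + monom (frob 1 C) (q\<^sup>2 + 1) + monom (frob 2 C) (q + 1)
    + monom D (q + q\<^sup>2 + 1)"
  have "val_at g (Some t) = poly p t" for t
    unfolding g val_at_Some_expand p_def by (simp add: poly_monom power_add frob_def mult_ac)
  then have poly_p: "poly p t = 0" for t
    using assms by simp
  have "2 * q \<le> q\<^sup>2" "2 * q\<^sup>2 \<le> q ^ 3"
    using q_gt_1 by (simp_all add: power2_eq_square power3_eq_cube)
  then have exponents: "q + 1 < q\<^sup>2" "q + q\<^sup>2 + 1 < q ^ 3"
    using q_gt_1 by linarith+
  have "degree p \<le> q + q\<^sup>2 + 1"
    unfolding p_def by (intro degree_add_le order.trans[OF degree_monom_le]) auto
  then have "p = 0"
    using card_poly_roots_bound[of p] poly_p exponents by (auto simp: card_UNIV)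
  then have "coeff p 0 = 0" "coeff p 1 = 0" "coeff p (q + q\<^sup>2) = 0" "coeff p (q + q\<^sup>2 + 1) = 0"
    by simp_all
  moreover define r where "r = q\<^sup>2"
  ultimately show ?thesis
    unfolding p_def g r_def[symmetric] using exponents(1)[folded r_def] q_gt_1
    by (simp add: coeff_monom zero_prod_def)
qed

lemma subspace_dim_7_eq_hyperplane:
  assumes "H \<subseteq> U1 q" and "fq_subspace_dim q H 7"
  obtains F where "F \<in> dual" "H = hyperplane F"
proof -
  have "q \<le> card (annihilator H)"
    using card_annihilator_subspace[OF assms] by simp
  then have "\<not> annihilator H \<subseteq> {0}"
    using q_gt_1 card_mono[of "{0}" "annihilator H"] by auto
  then obtain F where "F \<in> annihilator H" "F \<noteq> 0"
    by blast
  then have F: "F \<in> dual" "F \<noteq> 0" "H \<subseteq> hyperplane F"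
    using assms(1) by (auto simp: annihilator_def hyperplane_def)
  then obtain P where "P \<notin> zeros F"
    using covector_eq_0_if_val_at_eq_0[of F] by (auto simp: zeros_def)
  then have "\<not> U1 q \<subseteq> hyperplane F"
    using ovoid_vec_in_U1 ovoid_vec_in_hyperplane_iff by blast
  then have "card (hyperplane F) * q = card (U1 q :: (nat \<Rightarrow> 'a) set)"
    using card_Int_hyperplane[OF fq_subspace_U1 _ F(1)] hyperplane_subset_U1
    by (simp add: Int_absorb1)
  also have "\<dots> \<le> q ^ 7 * q"
    using card_U1_le by (simp flip: power_Suc2)
  finally have "card (hyperplane F) \<le> card H"
    using assms(2) q_gt_1 by (simp add: fq_subspace_dim_iff card_Fq)
  then have "H = hyperplane F"
    using F(3) finite_subset[OF hyperplane_subset_U1 finite_U1] by (intro card_seteq)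
  with F(1) that show ?thesis
    by blast
qed

subsection \<open>The trilinear form of a functional and its Hessian\<close>

lemma range_to_ac: "range (to_ac :: 'a \<Rightarrow> _) = {x. frob 3 x = x}"
proof (rule card_seteq)
  have "1 < q ^ 3"
    using q_gt_1 by (intro one_less_power) auto
  then have "finite {x :: 'a alg_closure. frob 3 x = x}"
    and "card {x :: 'a alg_closure. frob 3 x = x} \<le> q ^ 3"
    unfolding frob_def by (simp_all only: finite_power_eq_self card_power_eq_self)
  then show "finite {x :: 'a alg_closure. frob 3 x = x}"
    and "card {x :: 'a alg_closure. frob 3 x = x} \<le> card (range (to_ac :: 'a \<Rightarrow> _))"
    by (simp_all add: card_image inj_to_ac card_UNIV)
qed (auto simp: frob_to_ac)

lemma in_Fq_if_frob_1_eq: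
  assumes "frob 1 x = (x :: 'a alg_closure)"
  obtains l where "l \<in> Fqa" "x = to_ac l"
proof -
  have "frob 3 x = x"
    using assms frob_frob[of 1 1 x] frob_frob[of 1 2 x] by simp
  then obtain l where l: "x = to_ac l"
    using range_to_ac by auto
  then have "l \<in> Fqa"
    using assms by (simp add: Fq_iff frob_to_ac)
  with l that show ?thesis
    by blast
qed

abbreviation frob_vec :: "nat \<Rightarrow> 'a alg_closure \<times> 'a alg_closure \<Rightarrow> 'a alg_closure \<times> 'a alg_closure"
  where "frob_vec n \<equiv> map_prod (frob n) (frob n)"

fun tri :: "'a covector \<Rightarrow> 'a alg_closure \<times> 'a alg_closure \<Rightarrow> 'a alg_closure \<times> 'a alg_closure
    \<Rightarrow> 'a alg_closure \<times> 'a alg_closure \<Rightarrow> 'a alg_closure" where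
  "tri (A, B, C, D) (x0, y0) (x1, y1) (x2, y2) = to_ac A * y0 * y1 * y2
     + to_ac B * x0 * y1 * y2 + to_ac (frob 1 B) * y0 * x1 * y2 + to_ac (frob 2 B) * y0 * y1 * x2
     + to_ac C * y0 * x1 * x2 + to_ac (frob 1 C) * x0 * y1 * x2 + to_ac (frob 2 C) * x0 * x1 * y2
     + to_ac D * x0 * x1 * x2"

lemma tri_linear:
  "tri g (a * x + b * x', a * y + b * y') v w = a * tri g (x, y) v w + b * tri g (x', y') v w"
  "tri g u (a * x + b * x', a * y + b * y') w = a * tri g u (x, y) w + b * tri g u (x', y') w"
  "tri g u v (a * x + b * x', a * y + b * y') = a * tri g u v (x, y) + b * tri g u v (x', y')"
  by (cases g; cases u; cases v; cases w; simp add: algebra_simps)+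

lemma tri_homogeneous:
  "tri g (a * x0, a * y0) (b * x1, b * y1) (c * x2, c * y2)
    = a * b * c * tri g (x0, y0) (x1, y1) (x2, y2)"
  by (cases g) (simp add: algebra_simps)

lemma tri_diff: "tri (g - h) u v w = tri g u v w - tri h u v w"
  by (cases g; cases h; cases u; cases v; cases w) (simp add: frob_diff algebra_simps)

lemma tri_scale: "l \<in> Fqa \<Longrightarrow> tri (scale_covector l g) u v w = to_ac l * tri g u v w"
  by (cases g; cases u; cases v; cases w) (simp add: frob_mult frob_Fq algebra_simps)

lemma tri_frob:
  assumes "g \<in> dual"
  shows "frob 1 (tri g u v w) = tri g (frob_vec 1 w) (frob_vec 1 u) (frob_vec 1 v)"
  using assms by (cases g; cases u; cases v; cases w)
    (simp add: dual_def frob_add frob_mult frob_to_ac frob_Fq algebra_simps)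

fun proj_vec :: "'a option \<Rightarrow> 'a alg_closure \<times> 'a alg_closure" where
  "proj_vec None = (1, 0)"
| "proj_vec (Some t) = (to_ac t, 1)"

lemma to_ac_val_at:
  "to_ac (val_at g P) = tri g (proj_vec P) (frob_vec 1 (proj_vec P)) (frob_vec 2 (proj_vec P))"
  by (cases g; cases P) (simp_all add: val_at_None val_at_Some_expand frob_to_ac)

text \<open>The determinant of the bilinear form \<open>tri g (x, y)\<close>.\<close>

fun hessian :: "'a covector \<Rightarrow> 'a alg_closure \<times> 'a alg_closure \<Rightarrow> 'a alg_closure" where
  "hessian (A, B, C, D) (x, y) = (to_ac A * y + to_ac B * x) * (to_ac C * y + to_ac D * x)
     - (to_ac (frob 1 B) * y + to_ac (frob 2 C) * x)
       * (to_ac (frob 2 B) * y + to_ac (frob 1 C) * x)"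

lemma hessian_eq_0_if_degenerate:
  assumes "\<And>v. tri g u v w = 0" and "w \<noteq> (0, 0)"
  shows "hessian g u = 0"
proof -
  obtain A B C D x0 y0 x2 y2 where g: "g = (A, B, C, D)" and u: "u = (x0, y0)" and w: "w = (x2, y2)"
    by (cases g; cases u; cases w)
  have "y2 * hessian g u = (to_ac C * y0 + to_ac D * x0) * tri g u (0, 1) w
      - (to_ac (frob 2 B) * y0 + to_ac (frob 1 C) * x0) * tri g u (1, 0) w"
    "x2 * hessian g u = (to_ac A * y0 + to_ac B * x0) * tri g u (1, 0) w
      - (to_ac (frob 1 B) * y0 + to_ac (frob 2 C) * x0) * tri g u (0, 1) w"
    by (simp_all add: g u w algebra_simps)
  then show ?thesis
    using assms by (auto simp: w)
qed

lemma hessian_eq_0_imp_degenerate: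
  assumes "hessian g u = 0"
  obtains v where "v \<noteq> (0, 0)" "\<And>w. tri g u v w = 0"
proof -
  obtain A B C D x0 y0 where g: "g = (A, B, C, D)" and u: "u = (x0, y0)"
    by (cases g; cases u)
  define a b c d where "a = to_ac A * y0 + to_ac B * x0"
    and "b = to_ac (frob 1 B) * y0 + to_ac (frob 2 C) * x0"
    and "c = to_ac (frob 2 B) * y0 + to_ac (frob 1 C) * x0" and "d = to_ac C * y0 + to_ac D * x0"
  have tri: "tri g u (x1, y1) (x2, y2) = (a * y1 + b * x1) * y2 + (c * y1 + d * x1) * x2"
    for x1 y1 x2 y2
    by (simp add: g u a_def b_def c_def d_def algebra_simps)
  have "a * d = b * c"
    using assms by (simp add: g u a_def b_def c_def d_def)
  then consider (row2) "(c, d) \<noteq> (0, 0)" "c * d + d * - c = 0" "a * d + b * - c = 0"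
    | (row1) "(a, b) \<noteq> (0, 0)" "a * b + b * - a = 0" "c * b + d * - a = 0"
    | (zero) "a = 0" "b = 0" "c = 0" "d = 0"
    by (cases "(c, d) = (0, 0)") auto
  then show ?thesis
  proof cases
    case row2
    then show ?thesis
      by (intro that[of "(- c, d)"]) (auto simp only: tri split_paired_all, auto)
  next
    case row1
    then show ?thesis
      by (intro that[of "(- a, b)"]) (auto simp only: tri split_paired_all, auto)
  next
    case zero
    then show ?thesis
      by (intro that[of "(1, 0)"]) (auto simp: tri split_paired_all)
  qed
qed

lemma hessian_homogeneous: "hessian g (c * x, c * y) = c\<^sup>2 * hessian g (x, y)"
  by (cases g) (simp add: power2_eq_square algebra_simps)

lemma frob_3_hessian:
  assumes "g \<in> dual"
  shows "frob 3 (hessian g v) = hessian g (frob_vec 3 v)"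
  using assms by (cases g; cases v) (simp add: frob_diff frob_add frob_mult frob_to_ac)

subsection \<open>Functionals whose Hessian has a rational root\<close>

lemma card_zeros_norm_form:
  assumes "(A, B, C, D) \<in> dual" and "D \<noteq> 0" and BD: "B * D = frob 1 C * frob 2 C"
  shows "card (zeros (A, B, C, D)) \<in> {1, q\<^sup>2 + q + 1}"
proof -
  define n where "n = rel_norm C - A * D\<^sup>2"
  have D: "D \<in> Fqa" and "n \<in> Fqa"
    using assms(1) rel_norm_in_Fq[of C]
    by (auto simp: dual_def n_def power2_eq_square intro!: Fq_diff Fq_mult)
  have BD_conj: "frob 1 B * D = frob 2 C * C" "frob 2 B * D = C * frob 1 C"
    using arg_cong[OF BD, of "frob 1"] arg_cong[OF BD, of "frob 2"] D
    by (simp_all add: frob_mult frob_Fq)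
  have "rel_norm (D * t + C) = n + D\<^sup>2 * val_at (A, B, C, D) (Some t)" for t
  proof -
    have "rel_norm (D * t + C) = n + D\<^sup>2 * A
        + D * (frob 1 C * frob 2 C * t + frob 2 C * C * frob 1 t + C * frob 1 C * frob 2 t)
        + D\<^sup>2 * (C * frob 1 t * frob 2 t + frob 1 C * frob 2 t * t + frob 2 C * t * frob 1 t)
        + D ^ 3 * (t * frob 1 t * frob 2 t)"
      using D by (simp add: rel_norm_def n_def frob_add frob_mult frob_Fq algebra_simps
          power2_eq_square power3_eq_cube)
    then show ?thesis
      unfolding val_at_Some_expand BD[symmetric] BD_conj[symmetric]
      by (simp add: algebra_simps power2_eq_square power3_eq_cube)
  qed
  then have "P \<in> zeros (A, B, C, D) \<longleftrightarrow> P \<in> Some ` {t. rel_norm (D * t + C) = n}" for P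
    using \<open>D \<noteq> 0\<close> by (cases P) (auto simp: zeros_def val_at_None)
  then have "zeros (A, B, C, D) = Some ` {t. rel_norm (D * t + C) = n}"
    by blast
  then have "card (zeros (A, B, C, D)) = card {t. rel_norm (D * t + C) = n}"
    by (simp add: card_image)
  also have "bij_betw (\<lambda>t. D * t + C) {t. rel_norm (D * t + C) = n} {y. rel_norm y = n}"
    using \<open>D \<noteq> 0\<close> by (intro bij_betw_byWitness[of _ "\<lambda>y. (y - C) / D"]) auto
  then have "card {t. rel_norm (D * t + C) = n} = card {y. rel_norm y = n}"
    by (rule bij_betw_same_card)
  also have "\<dots> \<in> {1, q\<^sup>2 + q + 1}"
    using card_rel_norm_fibre \<open>n \<in> Fqa\<close> by (cases "n = 0") auto
  finally show ?thesis .
qed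

lemma card_zeros_trace_form:
  assumes "A \<in> Fqa"
  shows "card (zeros (A, B, 0, 0)) \<in> {1, q\<^sup>2 + 1, q ^ 3 + 1}"
proof -
  let ?affine = "{t. rel_trace (B * t) = - A}"
  have "P \<in> zeros (A, B, 0, 0) \<longleftrightarrow> P \<in> insert None (Some ` ?affine)" for P
    by (cases P)
      (auto simp: zeros_def val_at_None val_at_Some rel_trace_def eq_neg_iff_add_eq_0 add_ac)
  then have "zeros (A, B, 0, 0) = insert None (Some ` ?affine)"
    by blast
  then have card: "card (zeros (A, B, 0, 0)) = card ?affine + 1"
    by (simp add: card_image)
  show ?thesis
  proof (cases "B = 0")
    case True
    then have "?affine = UNIV \<or> ?affine = {}"
      by auto
    then show ?thesis
      using card by (auto simp: card_UNIV)
  next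
    case False
    then have "bij_betw ((*) B) ?affine {y. rel_trace y = - A}"
      by (intro bij_betw_byWitness[of _ "\<lambda>y. y / B"]) auto
    then show ?thesis
      using card card_rel_trace_fibre[of "- A"] assms by (simp add: bij_betw_same_card Fq_uminus)
  qed
qed

lemma card_zeros_if_hessian_infinity:
  assumes g: "g \<in> dual" and "hessian g (proj_vec None) = 0"
  shows "card (zeros g) \<in> {1, q\<^sup>2 + 1, q\<^sup>2 + q + 1, q ^ 3 + 1}"
proof -
  obtain A B C D where g_eq: "g = (A, B, C, D)"
    by (cases g)
  have "to_ac (B * D) = to_ac (frob 1 C * frob 2 C)"
    using assms(2) by (simp add: g_eq mult.commute)
  then have BD: "B * D = frob 1 C * frob 2 C"
    by (simp only: to_ac_eq_iff)
  show ?thesis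
  proof (cases "D = 0")
    case True
    then have "C = 0"
      using BD by simp
    then show ?thesis
      using card_zeros_trace_form[of A B] g True by (auto simp: g_eq dual_def)
  next
    case False
    then show ?thesis
      using card_zeros_norm_form[of A B C D] g BD by (auto simp: g_eq)
  qed
qed

text \<open>The functional in the parameter \<open>s\<close> with \<open>t = e + 1 / s\<close>: its coefficients are the
  values of \<open>tri\<close> at the conjugates of \<open>(1, 0)\<close> and \<open>(e, 1)\<close>.\<close>

fun invert_at :: "'a \<Rightarrow> 'a covector \<Rightarrow> 'a covector" where
  "invert_at e (A, B, C, D) = (D, C + D * e,
     B + frob 1 C * frob 2 e + frob 2 C * frob 1 e + D * frob 1 e * frob 2 e,
     val_at (A, B, C, D) (Some e))"

fun inverse_at :: "'a \<Rightarrow> 'a option \<Rightarrow> 'a option" where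
  "inverse_at e None = Some e"
| "inverse_at e (Some s) = (if s = 0 then None else Some (e + 1 / s))"

lemma bij_inverse_at: "bij (inverse_at e)"
proof (rule bij_betw_byWitness[where A' = UNIV])
  let ?inverse = "\<lambda>P. case P of None \<Rightarrow> Some 0 | Some t \<Rightarrow> if t = e then None else Some (1 / (t - e))"
  show "\<forall>P\<in>UNIV. ?inverse (inverse_at e P) = P"
  proof
    show "?inverse (inverse_at e P) = P" for P
      by (cases P) auto
  qed
  show "\<forall>P\<in>UNIV. inverse_at e (?inverse P) = P"
    by (auto split: option.splits)
qed auto

lemma invert_at_in_dual: "g \<in> dual \<Longrightarrow> invert_at e g \<in> dual"
  using val_at_in_Fq[of g "Some e"] by (cases g) (auto simp: dual_def)

lemma val_at_invert_at_eq_0_iff: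
  assumes "g \<in> dual"
  shows "val_at (invert_at e g) P = 0 \<longleftrightarrow> val_at g (inverse_at e P) = 0"
proof -
  obtain A B C D where g: "g = (A, B, C, D)"
    by (cases g)
  then have D: "D \<in> Fqa"
    using assms by (simp add: dual_def)
  have inverted: "val_at (invert_at e g) (Some s) = rel_norm s * val_at g (Some (e + 1 / s))"
    if "s \<noteq> 0" for s
    using that D unfolding g invert_at.simps val_at_Some_expand rel_norm_def
    by (simp add: frob_add frob_mult frob_divide frob_Fq field_simps)
  show ?thesis
  proof (cases P)
    case None
    then show ?thesis
      by (simp add: g val_at_None)
  next
    case (Some s)
    then show ?thesis
      using inverted[of s] by (cases "s = 0") (simp_all add: g val_at_None val_at_Some_expand)
  qed
qed

lemma hessian_invert_at:
  assumes "g \<in> dual"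
  shows "hessian (invert_at e g) (proj_vec None) = hessian g (proj_vec (Some e))"
proof -
  obtain A B C D where g: "g = (A, B, C, D)"
    by (cases g)
  then have "D \<in> Fqa"
    using assms by (simp add: dual_def)
  then show ?thesis
    by (simp add: g val_at_Some_expand frob_add frob_mult frob_Fq algebra_simps)
qed

lemma card_zeros_if_hessian_root:
  assumes g: "g \<in> dual" and "hessian g (proj_vec P) = 0"
  shows "card (zeros g) \<in> {1, q\<^sup>2 + 1, q\<^sup>2 + q + 1, q ^ 3 + 1}"
proof (cases P)
  case None
  then show ?thesis
    using assms by (intro card_zeros_if_hessian_infinity) simp_all
next
  case (Some e)
  have "bij_betw (inverse_at e) (zeros (invert_at e g)) (zeros g)"
    using bij_inverse_at[of e] val_at_invert_at_eq_0_iff[OF g, of e]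
    by (auto simp: bij_def bij_betw_def zeros_def inj_on_def image_iff)
  then have "card (zeros g) = card (zeros (invert_at e g))"
    by (simp add: bij_betw_same_card)
  also have "\<dots> \<in> {1, q\<^sup>2 + 1, q\<^sup>2 + q + 1, q ^ 3 + 1}"
    using assms(2) Some hessian_invert_at[OF g, of e]
    by (intro card_zeros_if_hessian_infinity invert_at_in_dual g) simp
  finally show ?thesis .
qed

lemma hessian_no_rational_root:
  assumes "g \<in> dual" and "card (zeros g) = q\<^sup>2 - q + 1"
  shows "hessian g (proj_vec P) \<noteq> 0"
proof
  assume "hessian g (proj_vec P) = 0"
  then have "q\<^sup>2 - q + 1 \<in> {1, q\<^sup>2 + 1, q\<^sup>2 + q + 1, q ^ 3 + 1}"
    using card_zeros_if_hessian_root assms by metis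
  moreover have "2 * q \<le> q\<^sup>2" "2 * q\<^sup>2 \<le> q ^ 3"
    using q_gt_1 by (simp_all add: power2_eq_square power3_eq_cube)
  ultimately show False
    using q_gt_1 by auto
qed

subsection \<open>Functionals whose Hessian has no rational root\<close>

lemma hessian_roots:
  assumes "g \<in> dual" and no_root: "\<And>P. hessian g (proj_vec P) \<noteq> 0"
  obtains \<theta> where "frob 3 \<theta> \<noteq> \<theta>" "frob 6 \<theta> = \<theta>" "\<And>x. hessian g (x, 1) = 0 \<longleftrightarrow> x = \<theta> \<or> x = frob 3 \<theta>"
proof -
  obtain A B C D where g: "g = (A, B, C, D)"
    by (cases g)
  define a b c where "a = hessian g (1, 0)"
    and "b = to_ac (A * D + B * C - (frob 1 B * frob 1 C + frob 2 C * frob 2 B))"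
    and "c = hessian g (0, 1)"
  have quadratic: "hessian g (x, 1) = a * x\<^sup>2 + b * x + c" for x
    by (simp add: g a_def b_def c_def power2_eq_square algebra_simps)
  have "a \<noteq> 0"
    using no_root[of None] by (simp add: a_def)
  then obtain \<theta> where \<theta>: "hessian g (\<theta>, 1) = 0"
    using alg_closed_imp_poly_has_root[of "[:c, b, a:]"]
    by (auto simp: quadratic power2_eq_square algebra_simps)
  have root_frob_3: "hessian g (frob 3 x, 1) = 0" if "hessian g (x, 1) = 0" for x
    using frob_3_hessian[OF \<open>g \<in> dual\<close>, of "(x, 1)"] that by simp
  have not_rational: "frob 3 x \<noteq> x" if "hessian g (x, 1) = 0" for x
  proof
    assume "frob 3 x = x"
    then obtain t where "x = to_ac t"
      using range_to_ac by auto
    then show False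
      using no_root[of "Some t"] that by simp
  qed
  have root_cases: "x = \<theta> \<or> x = frob 3 \<theta>" if "hessian g (x, 1) = 0" for x
    using quadratic_root_cases[OF \<open>a \<noteq> 0\<close>, of \<theta> "frob 3 \<theta>" b c x]
      not_rational[OF \<theta>] that \<theta> root_frob_3[OF \<theta>] by (simp add: quadratic)
  moreover have "frob 6 \<theta> = \<theta>"
    using root_cases[OF root_frob_3[OF root_frob_3[OF \<theta>]]]
      not_rational[OF root_frob_3[OF \<theta>]] by simp
  ultimately show ?thesis
    using that[of \<theta>] not_rational[OF \<theta>] \<theta> root_frob_3[OF \<theta>] by blast
qed

lemma degenerate_partner_of_hessian_root:
  assumes g: "g \<in> dual" and no_root: "\<And>P. hessian g (proj_vec P) \<noteq> 0"
    and \<theta>: "frob 6 \<theta> = \<theta>" and roots: "\<And>x. hessian g (x, 1) = 0 \<longleftrightarrow> x = \<theta> \<or> x = frob 3 \<theta>"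
  obtains s where "s = frob 1 \<theta> \<or> s = frob 4 \<theta>" "\<And>w. tri g (\<theta>, 1) (s, 1) w = 0"
proof -
  obtain x y where xy: "(x, y) \<noteq> (0, 0)" "\<And>w. tri g (\<theta>, 1) (x, y) w = 0"
    using hessian_eq_0_imp_degenerate[of g "(\<theta>, 1)"] roots by (metis surj_pair)
  \<comment> \<open>Two applications of Frobenius move \<open>(x, y)\<close> to the first argument of the form.\<close>
  have "tri g (frob 2 x, frob 2 y) w (frob 2 \<theta>, 1) = 0" for w
  proof -
    obtain w0 w1 where "frob 2 w0 = fst w" "frob 2 w1 = snd w"
      using frob_surjective by metis
    then have w: "w = frob_vec 2 (w0, w1)"
      by (simp add: prod_eq_iff)
    have "frob 1 (frob 1 (tri g (\<theta>, 1) (x, y) (w0, w1)))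
        = tri g (frob 2 x, frob 2 y) w (frob 2 \<theta>, 1)"
      unfolding tri_frob[OF g] by (simp add: w)
    then show ?thesis
      using xy(2) by simp
  qed
  then have root: "hessian g (frob 2 x, frob 2 y) = 0"
    by (rule hessian_eq_0_if_degenerate) simp
  have "y \<noteq> 0"
    using root xy(1) no_root[of None] hessian_homogeneous[of g "frob 2 x" 1 0] by auto
  then have "hessian g (frob 2 (x / y), 1) = 0"
    using root hessian_homogeneous[of g "1 / frob 2 y" "frob 2 x" "frob 2 y"]
    by (simp add: frob_divide)
  then have "frob 2 (x / y) = frob 2 (frob 4 \<theta>) \<or> frob 2 (x / y) = frob 2 (frob 1 \<theta>)"
    using roots \<theta> by simp
  then have "x / y = frob 1 \<theta> \<or> x / y = frob 4 \<theta>"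
    by (auto simp only: frob_eq_iff)
  moreover have "tri g (\<theta>, 1) (x / y, 1) w = 0" for w
    using tri_homogeneous[of g 1 \<theta> 1 "1 / y" x y 1 "fst w" "snd w"] xy(2) \<open>y \<noteq> 0\<close> by simp
  ultimately show ?thesis
    by (rule that)
qed

lemma elliptic_root:
  assumes g: "g \<in> dual" and no_root: "\<And>P. hessian g (proj_vec P) \<noteq> 0"
  obtains \<theta> where "frob 3 \<theta> \<noteq> \<theta>" "frob 6 \<theta> = \<theta>" "tri g (\<theta>, 1) (frob 1 \<theta>, 1) (frob 2 \<theta>, 1) = 0"
proof -
  obtain \<theta> where \<theta>: "frob 3 \<theta> \<noteq> \<theta>" "frob 6 \<theta> = \<theta>"
    and roots: "\<And>x. hessian g (x, 1) = 0 \<longleftrightarrow> x = \<theta> \<or> x = frob 3 \<theta>"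
    using hessian_roots[OF assms] by blast
  obtain s where s: "s = frob 1 \<theta> \<or> s = frob 4 \<theta>" "\<And>w. tri g (\<theta>, 1) (s, 1) w = 0"
    using degenerate_partner_of_hessian_root[OF assms \<theta>(2) roots] by blast
  have "tri g (\<theta>, 1) (frob 1 \<theta>, 1) (frob 2 \<theta>, 1) = 0"
    using s(1)
  proof
    assume "s = frob 1 \<theta>"
    then show ?thesis
      using s(2) by simp
  next
    assume "s = frob 4 \<theta>"
    moreover have "frob 1 (frob 1 (tri g (\<theta>, 1) (frob 4 \<theta>, 1) (frob 5 \<theta>, 1)))
        = tri g (\<theta>, 1) (frob 1 \<theta>, 1) (frob 2 \<theta>, 1)"
      unfolding tri_frob[OF g] using frob_frob[of 1 6 \<theta>] frob_frob[of 2 6 \<theta>] by (simp add: \<theta>(2))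
    ultimately show ?thesis
      using s(2)[of "(frob 5 \<theta>, 1)"] by simp
  qed
  with \<theta> that show ?thesis
    by blast
qed

end

subsection \<open>Coordinates adapted to the conjugate roots\<close>

locale elliptic_functional = cubic_extension q field_type
  for q :: nat and field_type :: "'a::{finite,field} itself" +
  fixes F :: "'a covector" and \<theta> :: "'a alg_closure" and base :: "'a option"
  assumes F_in_dual: "F \<in> dual" and card_zeros_F: "card (zeros F) = q\<^sup>2 - q + 1"
    and base_in_zeros: "base \<in> zeros F"
    and frob_3_\<theta>: "frob 3 \<theta> \<noteq> \<theta>" and frob_6_\<theta>: "frob 6 \<theta> = \<theta>"
    and tri_F_\<theta>: "tri F (\<theta>, 1) (frob 1 \<theta>, 1) (frob 2 \<theta>, 1) = 0"

lemma (in cubic_extension) elliptic_functional_exists: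
  assumes "F \<in> dual" and "card (zeros F) = q\<^sup>2 - q + 1"
  shows "\<exists>\<theta> base. elliptic_functional q F \<theta> base"
proof -
  obtain \<theta> where \<theta>: "frob 3 \<theta> \<noteq> \<theta>" "frob 6 \<theta> = \<theta>"
    "tri F (\<theta>, 1) (frob 1 \<theta>, 1) (frob 2 \<theta>, 1) = 0"
    using elliptic_root[OF assms(1) hessian_no_rational_root[OF assms]] by blast
  have "zeros F \<noteq> {}"
    using assms(2) by auto
  then obtain base where "base \<in> zeros F"
    by blast
  then have "elliptic_functional q F \<theta> base"
    using assms \<theta> by unfold_locales
  then show ?thesis
    by blast
qed

context elliptic_functional
begin

definition root_coord :: "'a option \<Rightarrow> 'a alg_closure" where
  "root_coord P = (fst (proj_vec P) - frob 3 \<theta> * snd (proj_vec P)) / (\<theta> - frob 3 \<theta>)"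

text \<open>Dividing by \<open>root_coord base\<close> makes \<open>coord_norm\<close> below equal to 1 at the zero \<open>base\<close> of \<open>F\<close>.\<close>

definition coord :: "'a option \<Rightarrow> 'a alg_closure" where
  "coord P = root_coord P / root_coord base"

definition vertex :: "nat \<Rightarrow> 'a alg_closure \<times> 'a alg_closure" where
  "vertex n = (frob n (\<theta> * root_coord base), frob n (root_coord base))"

lemma frob_9_\<theta>: "frob 9 \<theta> = frob 3 \<theta>"
  using frob_frob[of 3 6 \<theta>] by (simp add: frob_6_\<theta>)

lemma frob_proj_vec:
  "frob 3 (fst (proj_vec P)) = fst (proj_vec P)" "frob 3 (snd (proj_vec P)) = snd (proj_vec P)"
  by (cases P; simp add: frob_to_ac)+

lemma frob_3_root_coord:
  "frob 3 (root_coord P) = - ((fst (proj_vec P) - \<theta> * snd (proj_vec P)) / (\<theta> - frob 3 \<theta>))"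
  by (simp add: root_coord_def frob_divide frob_diff frob_mult frob_proj_vec frob_6_\<theta>
      flip: divide_minus_right)

lemma frob_6_root_coord: "frob 6 (root_coord P) = root_coord P"
  using frob_frob[of 3 3 "fst (proj_vec P)"] frob_frob[of 3 3 "snd (proj_vec P)"]
  by (simp add: root_coord_def frob_divide frob_diff frob_mult frob_proj_vec frob_6_\<theta> frob_9_\<theta>)

lemma root_coord_nonzero [simp]: "root_coord P \<noteq> 0"
proof
  assume "root_coord P = 0"
  then have fst_eq: "fst (proj_vec P) = frob 3 \<theta> * snd (proj_vec P)"
    using frob_3_\<theta> by (simp add: root_coord_def)
  then obtain t where "P = Some t"
    by (cases P) auto
  then have "frob 3 \<theta> = to_ac t"
    using fst_eq by simp
  then have "frob 3 (frob 3 \<theta>) = frob 3 \<theta>"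
    by (simp only: frob_to_ac frob_3)
  then show False
    using frob_6_\<theta> frob_3_\<theta> by simp
qed

lemma proj_vec_eq_root_coord:
  "proj_vec P = (root_coord P * \<theta> + frob 3 (root_coord P) * frob 3 \<theta>,
     root_coord P + frob 3 (root_coord P))"
proof -
  obtain x y where xy: "proj_vec P = (x, y)"
    by fastforce
  define d where "d = \<theta> - frob 3 \<theta>"
  then have "d \<noteq> 0"
    using frob_3_\<theta> by simp
  have root_coord_eqs: "root_coord P = (x - frob 3 \<theta> * y) / d"
    "frob 3 (root_coord P) = - ((x - \<theta> * y) / d)"
    by (simp_all add: frob_3_root_coord) (simp_all add: root_coord_def xy d_def)
  have "root_coord P * \<theta> + frob 3 (root_coord P) * frob 3 \<theta>
      = ((x - frob 3 \<theta> * y) * \<theta> - (x - \<theta> * y) * frob 3 \<theta>) / d"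
    unfolding root_coord_eqs(2) unfolding root_coord_eqs(1)
    by (simp add: diff_divide_distrib left_diff_distrib)
  also have "\<dots> = x * d / d"
    by (simp add: d_def algebra_simps)
  finally have fst_eq: "root_coord P * \<theta> + frob 3 (root_coord P) * frob 3 \<theta> = x"
    using \<open>d \<noteq> 0\<close> by simp
  have "root_coord P + frob 3 (root_coord P) = ((x - frob 3 \<theta> * y) - (x - \<theta> * y)) / d"
    unfolding root_coord_eqs(2) unfolding root_coord_eqs(1)
    by (simp add: diff_divide_distrib left_diff_distrib)
  also have "\<dots> = y * d / d"
    by (simp add: d_def algebra_simps)
  finally have "root_coord P + frob 3 (root_coord P) = y"
    using \<open>d \<noteq> 0\<close> by simp
  with fst_eq show ?thesis
    by (simp add: xy)
qed

lemma coord_nonzero [simp]: "coord P \<noteq> 0"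
  by (simp add: coord_def)

lemma coord_base [simp]: "coord base = 1"
  by (simp add: coord_def)

lemma frob_6_coord [simp]: "frob 6 (coord P) = coord P"
  by (simp add: coord_def frob_divide frob_6_root_coord)

lemma vertex_add_6 [simp]: "vertex 6 = vertex 0"
  by (simp add: vertex_def frob_mult frob_6_\<theta> frob_6_root_coord)

lemma frob_vec_proj_vec:
  "frob_vec n (proj_vec P) =
     (frob n (coord P) * fst (vertex n) + frob (n + 3) (coord P) * fst (vertex (n + 3)),
      frob n (coord P) * snd (vertex n) + frob (n + 3) (coord P) * snd (vertex (n + 3)))"
proof -
  have "root_coord P = coord P * root_coord base"
    by (simp add: coord_def)
  then show ?thesis
    unfolding proj_vec_eq_root_coord
    by (simp add: vertex_def frob_add frob_mult mult_ac)
qed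

definition coef :: "'a covector \<Rightarrow> nat \<Rightarrow> nat \<Rightarrow> nat \<Rightarrow> 'a alg_closure" where
  "coef g i j k = tri g (vertex i) (vertex j) (vertex k)"

lemma frob_coef: "g \<in> dual \<Longrightarrow> frob 1 (coef g i j k) = coef g (k + 1) (i + 1) (j + 1)"
  by (simp add: coef_def tri_frob vertex_def add.commute)

lemma coef_6 [simp]: "coef g 6 j k = coef g 0 j k" "coef g i 6 k = coef g i 0 k"
  by (simp_all add: coef_def)

text \<open>Frobenius permutes the eight coefficients \<open>coef g i j k\<close> with \<open>i \<in> {0, 3}\<close>, \<open>j \<in> {1, 4}\<close>,
  \<open>k \<in> {2, 5}\<close> in a cycle of length 6 and one of length 2.\<close>

definition \<beta> :: "'a covector \<Rightarrow> 'a alg_closure" where "\<beta> g = coef g 0 1 5"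

definition \<delta> :: "'a covector \<Rightarrow> 'a alg_closure" where "\<delta> g = coef g 0 4 2"

lemma frob_\<beta>:
  assumes "g \<in> dual"
  shows "frob 1 (\<beta> g) = coef g 0 1 2" "frob 2 (\<beta> g) = coef g 3 1 2" "frob 3 (\<beta> g) = coef g 3 4 2"
    "frob 4 (\<beta> g) = coef g 3 4 5" "frob 5 (\<beta> g) = coef g 0 4 5" "frob 6 (\<beta> g) = \<beta> g"
proof -
  have frob_1_plus: "frob (1 + n) x = frob 1 (frob n x)" for n and x :: "'a alg_closure"
    by (simp only: frob_frob)
  show frob_1_\<beta>: "frob 1 (\<beta> g) = coef g 0 1 2"
    by (simp add: \<beta>_def frob_coef[OF assms])
  show frob_2_\<beta>: "frob 2 (\<beta> g) = coef g 3 1 2"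
    using frob_1_plus[of 1 "\<beta> g"] by (simp add: frob_1_\<beta> frob_coef[OF assms])
  show frob_3_\<beta>: "frob 3 (\<beta> g) = coef g 3 4 2"
    using frob_1_plus[of 2 "\<beta> g"] by (simp add: frob_2_\<beta> frob_coef[OF assms])
  show frob_4_\<beta>: "frob 4 (\<beta> g) = coef g 3 4 5"
    using frob_1_plus[of 3 "\<beta> g"] by (simp add: frob_3_\<beta> frob_coef[OF assms])
  show frob_5_\<beta>: "frob 5 (\<beta> g) = coef g 0 4 5"
    using frob_1_plus[of 4 "\<beta> g"] by (simp add: frob_4_\<beta> frob_coef[OF assms])
  show "frob 6 (\<beta> g) = \<beta> g"
    using frob_1_plus[of 5 "\<beta> g"] by (simp add: frob_5_\<beta> frob_coef[OF assms]) (simp add: \<beta>_def)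
qed

lemma frob_\<delta>:
  assumes "g \<in> dual"
  shows "frob 1 (\<delta> g) = coef g 3 1 5" "frob 2 (\<delta> g) = \<delta> g"
proof -
  show frob_1_\<delta>: "frob 1 (\<delta> g) = coef g 3 1 5"
    by (simp add: \<delta>_def frob_coef[OF assms])
  have "frob 2 (\<delta> g) = frob 1 (frob 1 (\<delta> g))"
    by simp
  then show "frob 2 (\<delta> g) = \<delta> g"
    unfolding frob_1_\<delta> frob_coef[OF assms] by (simp add: \<delta>_def)
qed

definition coord_norm :: "'a option \<Rightarrow> 'a alg_closure" where
  "coord_norm P = coord P * frob 2 (coord P) * frob 4 (coord P)"

lemma frob_1_coord_norm:
  "frob 1 (coord_norm P) = frob 1 (coord P) * frob 3 (coord P) * frob 5 (coord P)"
  by (simp add: coord_norm_def frob_mult)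

lemma coord_norm_nonzero [simp]: "coord_norm P \<noteq> 0"
  by (simp add: coord_norm_def)

lemma frob_coord_reduce:
  "frob 7 (coord P) = frob 1 (coord P)" "frob 8 (coord P) = frob 2 (coord P)"
  "frob 9 (coord P) = frob 3 (coord P)" "frob 10 (coord P) = frob 4 (coord P)"
  using frob_frob[of 1 6 "coord P"] frob_frob[of 2 6 "coord P"] frob_frob[of 3 6 "coord P"]
    frob_frob[of 4 6 "coord P"] by simp_all

lemma to_ac_val_at_eq_trace6:
  assumes "g \<in> dual"
  shows "to_ac (val_at g P) = trace6 (\<beta> g * (coord P * frob 1 (coord P) * frob 5 (coord P)))
     + (\<delta> g * coord_norm P + frob 1 (\<delta> g * coord_norm P))"
proof -
  have expand: "proj_vec P = (coord P * fst (vertex 0) + frob 3 (coord P) * fst (vertex 3),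
      coord P * snd (vertex 0) + frob 3 (coord P) * snd (vertex 3))"
    using frob_vec_proj_vec[of 0 P] by (simp add: prod_eq_iff)
  have "to_ac (val_at g P) =
      coef g 0 1 5 * (coord P * frob 1 (coord P) * frob 5 (coord P))
    + coef g 0 1 2 * (coord P * frob 1 (coord P) * frob 2 (coord P))
    + coef g 3 1 2 * (frob 1 (coord P) * frob 2 (coord P) * frob 3 (coord P))
    + coef g 3 4 2 * (frob 2 (coord P) * frob 3 (coord P) * frob 4 (coord P))
    + coef g 3 4 5 * (frob 3 (coord P) * frob 4 (coord P) * frob 5 (coord P))
    + coef g 0 4 5 * (frob 4 (coord P) * frob 5 (coord P) * coord P)
    + (coef g 0 4 2 * (coord P * frob 2 (coord P) * frob 4 (coord P))
      + coef g 3 1 5 * (frob 1 (coord P) * frob 3 (coord P) * frob 5 (coord P)))"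
    unfolding to_ac_val_at frob_vec_proj_vec[of 1] frob_vec_proj_vec[of 2]
    by (subst expand, simp only: tri_linear prod.collapse) (simp add: coef_def algebra_simps)
  also have "\<dots> = trace6 (\<beta> g * (coord P * frob 1 (coord P) * frob 5 (coord P)))
      + (\<delta> g * coord_norm P + frob 1 (\<delta> g * coord_norm P))"
    by (simp add: trace6_def coord_norm_def frob_mult frob_\<beta>[OF assms] frob_\<delta>[OF assms]
        frob_coord_reduce mult_ac)
      (simp add: \<beta>_def \<delta>_def)
  finally show ?thesis .
qed

definition \<gamma> :: "'a covector \<Rightarrow> 'a alg_closure" where "\<gamma> g = \<delta> g + frob 1 (\<delta> g)"

definition z :: "'a option \<Rightarrow> 'a alg_closure" where "z P = coord P / frob 3 (coord P)"

lemma frob_\<gamma>: "g \<in> dual \<Longrightarrow> frob 1 (\<gamma> g) = \<gamma> g"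
  by (simp add: \<gamma>_def frob_add frob_\<delta>(2) add.commute)

lemma \<beta>_diff: "\<beta> (g - h) = \<beta> g - \<beta> h"
  and \<beta>_scale: "l \<in> Fqa \<Longrightarrow> \<beta> (scale_covector l g) = to_ac l * \<beta> g"
  and \<gamma>_diff: "\<gamma> (g - h) = \<gamma> g - \<gamma> h"
  by (simp_all add: \<beta>_def \<gamma>_def \<delta>_def coef_def tri_diff tri_scale frob_diff)

lemma \<beta>_F: "\<beta> F = 0"
proof -
  have "coef F 0 1 2 = 0"
    using tri_F_\<theta> tri_homogeneous[of F "root_coord base" \<theta> 1 "frob 1 (root_coord base)" "frob 1 \<theta>" 1
        "frob 2 (root_coord base)" "frob 2 \<theta>" 1]
    by (simp add: coef_def vertex_def frob_mult mult.commute)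
  then show ?thesis
    using frob_\<beta>(1)[OF F_in_dual] by simp
qed

lemma to_ac_val_at_F: "to_ac (val_at F P) = \<delta> F * coord_norm P + frob 1 (\<delta> F * coord_norm P)"
  by (simp add: to_ac_val_at_eq_trace6[OF F_in_dual] \<beta>_F trace6_def)

lemma frob_1_\<delta>_F: "frob 1 (\<delta> F) = - \<delta> F"
proof -
  have "coord_norm base = 1"
    by (simp add: coord_norm_def)
  then have "\<delta> F + frob 1 (\<delta> F) = 0"
    using to_ac_val_at_F[of base] base_in_zeros by (simp add: zeros_def)
  then show ?thesis
    by (simp add: eq_neg_iff_add_eq_0 add.commute)
qed

lemma to_ac_val_at_F_eq_diff: "to_ac (val_at F P) = \<delta> F * (coord_norm P - frob 1 (coord_norm P))"
  by (simp add: to_ac_val_at_F frob_mult frob_1_\<delta>_F algebra_simps)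

lemma zeros_F_neq_UNIV: "zeros F \<noteq> UNIV"
proof
  assume "zeros F = UNIV"
  then have "card (zeros F) = Suc (q ^ 3)"
    by (simp add: UNIV_option_conv card_image card_UNIV)
  moreover have "q\<^sup>2 < q ^ 3"
    using q_gt_1 by (intro power_strict_increasing) auto
  ultimately show False
    using card_zeros_F by linarith
qed

lemma \<delta>_F_nonzero: "\<delta> F \<noteq> 0"
  using to_ac_val_at_F_eq_diff zeros_F_neq_UNIV by (auto simp: zeros_def)

lemma frob_1_coord_norm_fixed: "P \<in> zeros F \<Longrightarrow> frob 1 (coord_norm P) = coord_norm P"
  using to_ac_val_at_F_eq_diff[of P] \<delta>_F_nonzero by (simp add: zeros_def)

lemma z_nonzero [simp]: "z P \<noteq> 0"
  by (simp add: z_def)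

lemma inj_z: "inj z"
proof (rule injI)
  fix P Q assume "z P = z Q"
  then have cross: "root_coord P * frob 3 (root_coord Q) = root_coord Q * frob 3 (root_coord P)"
    by (simp add: z_def coord_def frob_divide field_simps)
  obtain x y x' y' where P: "proj_vec P = (x, y)" and Q: "proj_vec Q = (x', y')"
    by fastforce
  have "(x - frob 3 \<theta> * y) * (x' - \<theta> * y') = (x' - frob 3 \<theta> * y') * (x - \<theta> * y)"
    using cross frob_3_\<theta> unfolding frob_3_root_coord unfolding root_coord_def P Q by simp
  then have "(\<theta> - frob 3 \<theta>) * (x' * y - x * y') = 0"
    by (simp add: algebra_simps)
  then have "x * y' = x' * y"
    using frob_3_\<theta> by simp
  then show "P = Q"
    using P Q by (cases P; cases Q) auto
qed

lemma frob_z: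
  assumes "P \<in> zeros F"
  shows "frob 2 (z P) = frob 1 (z P) / z P" "frob 3 (z P) = 1 / z P"
    "frob 4 (z P) = 1 / frob 1 (z P)" "frob 5 (z P) = z P / frob 1 (z P)"
proof -
  have "coord P * frob 2 (coord P) * frob 4 (coord P)
      = frob 1 (coord P) * frob 3 (coord P) * frob 5 (coord P)"
    using frob_1_coord_norm_fixed[OF assms] unfolding frob_1_coord_norm
    by (simp add: coord_norm_def)
  then show frob_2_z: "frob 2 (z P) = frob 1 (z P) / z P"
    by (simp add: z_def frob_divide field_simps)
  show frob_3_z: "frob 3 (z P) = 1 / z P"
    by (simp add: z_def frob_divide)
  show frob_4_z: "frob 4 (z P) = 1 / frob 1 (z P)"
    using arg_cong[OF frob_3_z, of "frob 1"] by (simp add: frob_divide)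
  show "frob 5 (z P) = z P / frob 1 (z P)"
    using arg_cong[OF frob_2_z, of "frob 3"] by (simp add: frob_divide frob_3_z frob_4_z)
qed

lemma to_ac_val_at_on_zeros_F:
  assumes "P \<in> zeros F" and "g \<in> dual"
  shows "to_ac (val_at g P) = coord_norm P * (\<gamma> g + trace6 (\<beta> g * z P))"
proof -
  have coord_norm: "coord_norm P = frob 1 (coord P) * frob 3 (coord P) * frob 5 (coord P)"
    using frob_1_coord_norm_fixed[OF assms(1)] by (simp add: frob_1_coord_norm)
  have "coord P * frob 1 (coord P) * frob 5 (coord P) = z P * coord_norm P"
    by (simp add: coord_norm z_def)
  then have "trace6 (\<beta> g * (coord P * frob 1 (coord P) * frob 5 (coord P)))
      = coord_norm P * trace6 (\<beta> g * z P)"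
    using trace6_mult_fixed[OF frob_1_coord_norm_fixed[OF assms(1)], of "\<beta> g * z P"]
    by (simp add: mult.assoc)
  then show ?thesis
    using to_ac_val_at_eq_trace6[OF assms(2), of P] frob_1_coord_norm_fixed[OF assms(1)]
    by (simp add: \<gamma>_def frob_mult algebra_simps)
qed

subsection \<open>Common zeros of functionals\<close>

definition multiples_F :: "'a covector set" where
  "multiples_F = (\<lambda>l. scale_covector l F) ` Fqa"

lemma card_multiples_F_le: "card multiples_F \<le> q"
  unfolding multiples_F_def using card_image_le[of Fqa] card_Fq by auto

lemma \<beta>_multiples_F: "g \<in> multiples_F \<Longrightarrow> \<beta> g = 0"
  by (auto simp: multiples_F_def \<beta>_scale \<beta>_F)

lemma in_multiples_F_if_coords_eq_0:
  assumes g: "g \<in> dual" and "\<beta> g = 0" and "\<gamma> g = 0"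
  shows "g \<in> multiples_F"
proof -
  have frob_\<delta>_g: "frob 1 (\<delta> g) = - \<delta> g"
    using \<open>\<gamma> g = 0\<close> by (simp add: \<gamma>_def eq_neg_iff_add_eq_0 add.commute)
  then have "frob 1 (\<delta> g / \<delta> F) = \<delta> g / \<delta> F"
    by (simp add: frob_divide frob_1_\<delta>_F)
  then obtain l where l: "l \<in> Fqa" "\<delta> g / \<delta> F = to_ac l"
    by (rule in_Fq_if_frob_1_eq)
  have "val_at g P = l * val_at F P" for P
  proof -
    have "to_ac (val_at g P) = \<delta> g * (coord_norm P - frob 1 (coord_norm P))"
      by (simp add: to_ac_val_at_eq_trace6[OF g] \<open>\<beta> g = 0\<close> trace6_def frob_mult frob_\<delta>_g
          algebra_simps)
    also have "\<dots> = to_ac l * to_ac (val_at F P)"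
      using \<delta>_F_nonzero by (simp add: to_ac_val_at_F_eq_diff flip: l(2))
    finally show ?thesis
      by (simp only: to_ac_eq_iff flip: to_ac_mult)
  qed
  then have "g - scale_covector l F = 0"
    by (intro covector_eq_0_if_val_at_eq_0) (simp add: val_at_diff val_at_scale l(1))
  then show ?thesis
    using l(1) by (simp add: multiples_F_def)
qed

lemma notin_zeros_if_\<beta>_eq_0:
  assumes "g \<in> dual" "g \<notin> multiples_F" "\<beta> g = 0" "P \<in> zeros F"
  shows "P \<notin> zeros g"
proof
  assume "P \<in> zeros g"
  then have "\<gamma> g = 0"
    using to_ac_val_at_on_zeros_F[OF assms(4,1)] assms(3) by (simp add: zeros_def trace6_def)
  then show False
    using in_multiples_F_if_coords_eq_0 assms by blast
qed

lemma card_le_degree_if_z_roots: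
  assumes "p \<noteq> 0" and "\<And>P. P \<in> S \<Longrightarrow> poly p (z P) = 0"
  shows "card S \<le> degree p"
proof -
  have "card S \<le> card {x. poly p x = 0}"
    using assms poly_roots_finite[OF \<open>p \<noteq> 0\<close>]
    by (intro card_inj_on_le[of z] inj_on_subset[OF inj_z]) auto
  also have "\<dots> \<le> degree p"
    using \<open>p \<noteq> 0\<close> by (rule card_poly_roots_bound)
  finally show ?thesis .
qed

text \<open>For \<open>u = z P\<close> and \<open>v = frob 1 u\<close>, the equation \<open>\<gamma> g + trace6 (\<beta> g * u) = 0\<close> becomes a
  quadratic in \<open>v\<close> with these coefficients, the constant one up to a factor \<open>u\<close>.\<close>

definition quad2 :: "'a covector \<Rightarrow> 'a alg_closure poly" where
  "quad2 g = [:frob 2 (\<beta> g), frob 1 (\<beta> g):]"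

definition quad1 :: "'a covector \<Rightarrow> 'a alg_closure poly" where
  "quad1 g = [:frob 3 (\<beta> g), \<gamma> g, \<beta> g:]"

definition quad0 :: "'a covector \<Rightarrow> 'a alg_closure poly" where
  "quad0 g = [:frob 4 (\<beta> g), frob 5 (\<beta> g):]"

lemma quadratic_if_zero:
  assumes P: "P \<in> zeros F" "P \<in> zeros g" and g: "g \<in> dual"
  shows "poly (quad2 g) (z P) * (frob 1 (z P))\<^sup>2 + poly (quad1 g) (z P) * frob 1 (z P)
    + z P * poly (quad0 g) (z P) = 0"
proof -
  define u v where "u = z P" and "v = frob 1 (z P)"
  have nonzero: "u \<noteq> 0" "v \<noteq> 0"
    by (simp_all add: u_def v_def)
  have "poly (quad2 g) u * v\<^sup>2 + poly (quad1 g) u * v + u * poly (quad0 g) u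
      = u * v * (\<gamma> g + (\<beta> g * u + frob 1 (\<beta> g) * v + frob 2 (\<beta> g) * (v / u)
        + frob 3 (\<beta> g) * (1 / u) + frob 4 (\<beta> g) * (1 / v) + frob 5 (\<beta> g) * (u / v)))"
    using nonzero by (simp add: quad2_def quad1_def quad0_def algebra_simps power2_eq_square)
  also have "\<dots> = u * v * (\<gamma> g + trace6 (\<beta> g * u))"
    unfolding trace6_def frob_mult u_def v_def frob_z[OF P(1)] ..
  also have "\<dots> = 0"
    using to_ac_val_at_on_zeros_F[OF P(1) g] P(2) by (simp add: zeros_def u_def)
  finally show ?thesis
    by (simp add: u_def v_def)
qed

definition eliminant :: "'a covector \<Rightarrow> 'a covector \<Rightarrow> 'a alg_closure poly" where
  "eliminant g h = [:0, 1:] * (quad2 g * quad0 h - quad2 h * quad0 g)\<^sup>2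
     - (quad2 g * quad1 h - quad2 h * quad1 g) * (quad1 g * quad0 h - quad1 h * quad0 g)"

lemma degree_eliminant_le: "degree (eliminant g h) \<le> 6"
proof -
  have degree_quad: "degree (quad2 f) \<le> 1" "degree (quad1 f) \<le> 2" "degree (quad0 f) \<le> 1" for f
    by (auto simp: quad2_def quad1_def quad0_def)
  have degree_mult: "degree (x * y) \<le> m + n" if "degree x \<le> m" "degree y \<le> n"
    for x y :: "'a alg_closure poly" and m n
    using that degree_mult_le[of x y] by linarith
  have "degree (quad2 g * quad0 h - quad2 h * quad0 g) \<le> 1 + 1"
    "degree (quad2 g * quad1 h - quad2 h * quad1 g) \<le> 1 + 2"
    "degree (quad1 g * quad0 h - quad1 h * quad0 g) \<le> 2 + 1"
    by (intro degree_diff_le degree_mult degree_quad)+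
  then have "degree ([:0, 1:] * (quad2 g * quad0 h - quad2 h * quad0 g)\<^sup>2) \<le> 1 + ((1 + 1) + (1 + 1))"
    "degree ((quad2 g * quad1 h - quad2 h * quad1 g) * (quad1 g * quad0 h - quad1 h * quad0 g))
      \<le> (1 + 2) + (2 + 1)"
    unfolding power2_eq_square by (intro degree_mult; simp)+
  then show ?thesis
    unfolding eliminant_def by (intro degree_diff_le) auto
qed

lemma eliminant_nonzero:
  assumes "\<beta> g * frob 1 (\<beta> h) \<noteq> \<beta> h * frob 1 (\<beta> g)"
  shows "eliminant g h \<noteq> 0"
proof -
  define w where "w = \<beta> g * frob 1 (\<beta> h) - \<beta> h * frob 1 (\<beta> g)"
  have "poly (eliminant g h) 0 = - (frob 2 w * frob 3 w)"
    by (simp add: eliminant_def quad2_def quad1_def quad0_def w_def frob_diff frob_mult mult_ac)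
  moreover have "w \<noteq> 0"
    using assms by (simp add: w_def)
  ultimately show ?thesis
    by auto
qed

lemma eliminant_root:
  assumes "P \<in> zeros F \<inter> zeros g \<inter> zeros h" and "g \<in> dual" and "h \<in> dual"
  shows "poly (eliminant g h) (z P) = 0"
proof -
  define u where "u = z P"
  have "u * poly (eliminant g h) u
      = (poly (quad2 g) u * (u * poly (quad0 h) u) - poly (quad2 h) u * (u * poly (quad0 g) u))\<^sup>2
        - (poly (quad2 g) u * poly (quad1 h) u - poly (quad2 h) u * poly (quad1 g) u)
          * (poly (quad1 g) u * (u * poly (quad0 h) u) - poly (quad1 h) u * (u * poly (quad0 g) u))"
    by (simp add: eliminant_def algebra_simps power2_eq_square)
  also have "\<dots> = 0"
    using quadratic_common_root_resultant[OF quadratic_if_zero quadratic_if_zero, of P g h] assms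
    by (simp add: u_def)
  finally show ?thesis
    by (simp add: u_def)
qed

definition independent_mod_F :: "'a covector \<Rightarrow> 'a covector \<Rightarrow> bool" where
  "independent_mod_F g h \<longleftrightarrow> g \<notin> multiples_F \<and> (\<forall>l\<in>Fqa. h - scale_covector l g \<notin> multiples_F)"

lemma common_zeros_empty_if_\<beta>_proportional:
  assumes g: "g \<in> dual" and h: "h \<in> dual" and indep: "independent_mod_F g h"
    and proportional: "\<beta> g * frob 1 (\<beta> h) = \<beta> h * frob 1 (\<beta> g)"
  shows "zeros F \<inter> zeros g \<inter> zeros h = {}"
proof (cases "\<beta> g = 0")
  case True
  then show ?thesis
    using notin_zeros_if_\<beta>_eq_0[OF g] indep by (auto simp: independent_mod_F_def)
next
  case False
  then have "frob 1 (\<beta> h / \<beta> g) = \<beta> h / \<beta> g"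
    using proportional by (simp add: frob_divide field_simps)
  then obtain l where l: "l \<in> Fqa" "\<beta> h / \<beta> g = to_ac l"
    by (rule in_Fq_if_frob_1_eq)
  then have "\<beta> (h - scale_covector l g) = 0"
    using False by (simp add: \<beta>_diff \<beta>_scale field_simps)
  then have "P \<notin> zeros (h - scale_covector l g)" if "P \<in> zeros F" for P
    using that g h indep l(1)
    by (intro notin_zeros_if_\<beta>_eq_0) (simp_all add: dual_diff dual_scale independent_mod_F_def)
  then show ?thesis
    by (force simp: zeros_def val_at_diff val_at_scale l(1))
qed

lemma card_common_zeros_le:
  assumes "g \<in> dual" and "h \<in> dual" and "independent_mod_F g h"
  shows "card (zeros F \<inter> zeros g \<inter> zeros h) \<le> 6"
proof (cases "\<beta> g * frob 1 (\<beta> h) = \<beta> h * frob 1 (\<beta> g)")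
  case True
  then show ?thesis
    using common_zeros_empty_if_\<beta>_proportional assms by simp
next
  case False
  have "card (zeros F \<inter> zeros g \<inter> zeros h) \<le> degree (eliminant g h)"
    using eliminant_nonzero[OF False] eliminant_root assms by (intro card_le_degree_if_z_roots)
  also have "\<dots> \<le> 6"
    by (rule degree_eliminant_le)
  finally show ?thesis .
qed

definition zeros_poly :: "'a covector \<Rightarrow> 'a alg_closure poly" where
  "zeros_poly g = monom (frob 1 (\<beta> g)) (2 * q + 1) + monom (frob 2 (\<beta> g)) (2 * q)
     + monom (\<beta> g) (q + 2) + monom (\<gamma> g) (q + 1) + monom (frob 3 (\<beta> g)) q
     + monom (frob 5 (\<beta> g)) 2 + monom (frob 4 (\<beta> g)) 1"

lemma zeros_poly_root:
  assumes "P \<in> zeros F" and "P \<in> zeros g" and "g \<in> dual"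
  shows "poly (zeros_poly g) (z P) = 0"
proof -
  define u v where "u = z P" and "v = frob 1 (z P)"
  have powers: "u ^ q = v" "u ^ (q * 2) = v * v"
    by (simp_all add: u_def v_def frob_def power_mult power2_eq_square)
  have "poly (zeros_poly g) u = poly (quad2 g) u * v\<^sup>2 + poly (quad1 g) u * v + u * poly (quad0 g) u"
    by (simp add: zeros_poly_def quad2_def quad1_def quad0_def poly_monom power_add powers
        algebra_simps power2_eq_square)
  also have "\<dots> = 0"
    using quadratic_if_zero[OF assms] by (simp add: u_def v_def)
  finally show ?thesis
    by (simp add: u_def)
qed

lemma in_multiples_F_if_vanishing_on_zeros:
  assumes "q \<ge> 4" and g: "g \<in> dual" and "zeros F \<subseteq> zeros g"
  shows "g \<in> multiples_F"
proof -
  have "zeros_poly g = 0"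
  proof (rule ccontr)
    assume "zeros_poly g \<noteq> 0"
    moreover have "poly (zeros_poly g) (z P) = 0" if "P \<in> zeros F" for P
      using zeros_poly_root[OF that _ g] that assms(3) by blast
    ultimately have "q\<^sup>2 - q + 1 \<le> degree (zeros_poly g)"
      unfolding card_zeros_F[symmetric] by (intro card_le_degree_if_z_roots)
    also have "degree (zeros_poly g) \<le> 2 * q + 1"
      unfolding zeros_poly_def using \<open>q \<ge> 4\<close>
      by (intro degree_add_le order.trans[OF degree_monom_le]) auto
    finally have "q\<^sup>2 - q \<le> 2 * q"
      by simp
    moreover have "4 * q \<le> q\<^sup>2"
      using \<open>q \<ge> 4\<close> by (simp add: power2_eq_square)
    ultimately show False
      using \<open>q \<ge> 4\<close> by linarith
  qed
  then have "coeff (zeros_poly g) (q + 1) = 0" "coeff (zeros_poly g) (q + 2) = 0"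
    by simp_all
  then have "\<gamma> g = 0" "\<beta> g = 0"
    using \<open>q \<ge> 4\<close> by (simp_all add: zeros_poly_def coeff_monom)
  then show ?thesis
    using in_multiples_F_if_coords_eq_0 g by blast
qed

lemma annihilator_zeros_F_subset_multiples_F:
  assumes "q \<ge> 4" and "\<And>P. P \<in> zeros F \<Longrightarrow> ovoid_vec P \<in> S"
  shows "annihilator S \<subseteq> multiples_F"
proof
  fix g assume "g \<in> annihilator S"
  then show "g \<in> multiples_F"
    using assms(2) in_zeros_if_annihilator annihilator_subset_dual
    by (intro in_multiples_F_if_vanishing_on_zeros[OF assms(1)]) blast+
qed

lemma independent_mod_F_exists:
  assumes "N \<subseteq> dual" and "q ^ 3 \<le> card N"
  obtains g h where "g \<in> N" "h \<in> N" "independent_mod_F g h"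
proof -
  have q3: "q < q ^ 3" "q\<^sup>2 < q ^ 3"
    using q_gt_1 power_strict_increasing[of 1 3 q] power_strict_increasing[of 2 3 q] by simp_all
  then have "\<not> N \<subseteq> multiples_F"
    using card_mono[of multiples_F N] card_multiples_F_le assms(2) by auto
  then obtain g where g: "g \<in> N" "g \<notin> multiples_F"
    by blast
  let ?dependent = "(\<lambda>(l, f). f + scale_covector l g) ` (Fqa \<times> multiples_F)"
  have "card ?dependent \<le> card (Fqa \<times> multiples_F)"
    by (rule card_image_le) simp
  also have "\<dots> \<le> q\<^sup>2"
    using card_multiples_F_le by (simp add: card_cartesian_product card_Fq power2_eq_square)
  finally have "\<not> N \<subseteq> ?dependent"
    using card_mono[of ?dependent N] assms(2) q3 by auto
  then obtain h where h: "h \<in> N" "h \<notin> ?dependent"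
    by blast
  have "h - scale_covector l g \<notin> multiples_F" if "l \<in> Fqa" for l
  proof
    assume "h - scale_covector l g \<in> multiples_F"
    then have "(h - scale_covector l g) + scale_covector l g \<in> ?dependent"
      using that by (intro image_eqI[of _ _ "(l, h - scale_covector l g)"]) auto
    then show False
      using h by simp
  qed
  with g h that show ?thesis
    by (simp add: independent_mod_F_def)
qed

subsection \<open>Functionals with eight zeros\<close>

definition pencil :: "'a covector \<Rightarrow> 'a covector \<Rightarrow> 'a covector set" where
  "pencil g h = insert g ((\<lambda>l. h - scale_covector l g) ` Fqa)"

lemma card_pencil_le: "card (pencil g h) \<le> q + 1"
proof -
  have "card (pencil g h) \<le> Suc (card ((\<lambda>l. h - scale_covector l g) ` Fqa))"
    unfolding pencil_def by (rule card_insert_le_m1) auto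
  also have "\<dots> \<le> Suc (card Fqa)"
    by (simp add: card_image_le)
  finally show ?thesis
    by (simp add: card_Fq)
qed

lemma pencil_subset_dual: "g \<in> dual \<Longrightarrow> h \<in> dual \<Longrightarrow> pencil g h \<subseteq> dual"
  by (auto simp: pencil_def dual_diff dual_scale)

lemma zero_of_pencil_exists:
  assumes "g \<in> dual" and "h \<in> dual"
  obtains f where "f \<in> pencil g h" "P \<in> zeros f"
proof (cases "P \<in> zeros g")
  case True
  then show ?thesis
    using that[of g] by (simp add: pencil_def)
next
  case False
  define l where "l = val_at h P / val_at g P"
  have "l \<in> Fqa"
    unfolding l_def using assms by (intro Fq_divide val_at_in_Fq)
  then have "P \<in> zeros (h - scale_covector l g)"
    using False by (simp add: zeros_def val_at_diff val_at_scale l_def)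
  then show ?thesis
    using that[of "h - scale_covector l g"] \<open>l \<in> Fqa\<close> by (simp add: pencil_def)
qed

lemma card_zeros_F_le_if_pencil:
  assumes "g \<in> dual" and "h \<in> dual" and S: "S \<subseteq> zeros F \<inter> zeros g \<inter> zeros h"
    and few: "\<And>f. f \<in> pencil g h \<Longrightarrow> card (zeros F \<inter> zeros f) \<le> card S + m"
  shows "card (zeros F) \<le> card S + m * (q + 1)"
proof -
  have S_zeros: "S \<subseteq> zeros F \<inter> zeros f" if "f \<in> pencil g h" for f
    using that subsetD[OF S] by (auto simp: pencil_def zeros_def val_at_diff val_at_scale)
  have "zeros F - S \<subseteq> (\<Union>f\<in>pencil g h. zeros F \<inter> zeros f - S)"
  proof
    fix P assume "P \<in> zeros F - S"
    moreover obtain f where "f \<in> pencil g h" "P \<in> zeros f"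
      using zero_of_pencil_exists assms(1,2) .
    ultimately show "P \<in> (\<Union>f\<in>pencil g h. zeros F \<inter> zeros f - S)"
      by blast
  qed
  then have "card (zeros F - S) \<le> card (\<Union>f\<in>pencil g h. zeros F \<inter> zeros f - S)"
    by (intro card_mono) auto
  also have "\<dots> \<le> (\<Sum>f\<in>pencil g h. card (zeros F \<inter> zeros f - S))"
    by (rule card_UN_le) simp
  also have "\<dots> \<le> (\<Sum>f\<in>pencil g h. m)"
  proof (rule sum_mono)
    fix f assume f: "f \<in> pencil g h"
    have "card (zeros F \<inter> zeros f - S) = card (zeros F \<inter> zeros f) - card S"
      using S_zeros[OF f] by (intro card_Diff_subset) auto
    then show "card (zeros F \<inter> zeros f - S) \<le> m"
      using few[OF f] by simp
  qed
  also have "\<dots> \<le> m * (q + 1)"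
    using card_pencil_le[of g h] by (simp add: mult.commute)
  also have "card (zeros F - S) = card (zeros F) - card S"
    using S by (intro card_Diff_subset) auto
  finally show ?thesis
    by simp
qed

lemma independent_mod_F_vanishing_at_five_exists:
  assumes S: "S \<subseteq> zeros F" "card S \<le> 5"
  obtains g h where "g \<in> dual" "h \<in> dual" "independent_mod_F g h"
    "S \<subseteq> zeros F \<inter> zeros g \<inter> zeros h"
proof -
  have "finite S"
    by simp
  then obtain Ps where Ps: "set Ps = S" "distinct Ps"
    using finite_distinct_list by blast
  then have "length Ps \<le> 5"
    using S(2) distinct_card by fastforce
  then have "q ^ 3 \<le> card (annihilator (set (map ovoid_vec Ps)))"
    using card_annihilator_ge[of "map ovoid_vec Ps" 5] ovoid_vec_in_U1 by auto
  then obtain g h where gh: "g \<in> annihilator (ovoid_vec ` S)" "h \<in> annihilator (ovoid_vec ` S)"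
    and "independent_mod_F g h"
    using independent_mod_F_exists[OF annihilator_subset_dual] Ps(1) by (metis list.set_map)
  moreover from gh have "S \<subseteq> zeros F \<inter> zeros g \<inter> zeros h"
    using S(1) in_zeros_if_annihilator by blast
  moreover have "g \<in> dual" "h \<in> dual"
    using gh annihilator_subset_dual by blast+
  ultimately show ?thesis
    using that by blast
qed

lemma eight_zeros_exist_large:
  assumes "q \<ge> 5"
  shows "\<exists>g\<in>dual. g \<notin> multiples_F \<and> 8 \<le> card (zeros F \<inter> zeros g)"
proof (rule ccontr)
  assume "\<not> ?thesis"
  then have few: "card (zeros F \<inter> zeros g) \<le> 7" if "g \<in> dual" "g \<notin> multiples_F" for g
    using that by force
  have "5 * q \<le> q\<^sup>2"
    using assms by (simp add: power2_eq_square)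
  then have card_ge: "4 * q + 1 \<le> card (zeros F)"
    using card_zeros_F by linarith
  then have "5 \<le> card (zeros F)"
    using assms by linarith
  then obtain S where S: "S \<subseteq> zeros F" "card S = 5"
    by (rule obtain_subset_with_card_n)
  then obtain g h where gh: "g \<in> dual" "h \<in> dual" "independent_mod_F g h"
    "S \<subseteq> zeros F \<inter> zeros g \<inter> zeros h"
    using independent_mod_F_vanishing_at_five_exists by (metis order_refl)
  have "card (zeros F \<inter> zeros f) \<le> card S + 2" if "f \<in> pencil g h" for f
  proof -
    have "f \<notin> multiples_F"
      using that gh(3) by (auto simp: pencil_def independent_mod_F_def)
    moreover have "f \<in> dual"
      using that pencil_subset_dual gh(1,2) by blast
    ultimately show ?thesis
      using few[of f] S(2) by simp
  qed
  then have "card (zeros F) \<le> card S + 2 * (q + 1)"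
    using gh by (intro card_zeros_F_le_if_pencil)
  then show False
    using S(2) card_ge assms by simp
qed

lemma z_power_eq_1:
  assumes "P \<in> zeros F"
  shows "z P ^ (q\<^sup>2 - q + 1) = 1"
proof -
  have "q \<le> q\<^sup>2"
    by (simp add: power2_eq_square)
  then have "z P ^ (q\<^sup>2 - q + 1) * frob 1 (z P) = frob 2 (z P) * z P"
    by (simp add: frob_def flip: power_add) (simp add: power_add)
  then show ?thesis
    using frob_z(1)[OF assms] by simp
qed

lemma z_image_zeros_F: "z ` zeros F = {x. x ^ (q\<^sup>2 - q + 1) = 1}"
proof (rule card_seteq)
  show "z ` zeros F \<subseteq> {x. x ^ (q\<^sup>2 - q + 1) = 1}"
    using z_power_eq_1 by blast
  show "card {x. x ^ (q\<^sup>2 - q + 1) = (1 :: 'a alg_closure)} \<le> card (z ` zeros F)"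
    by (simp add: card_image inj_on_subset[OF inj_z] card_zeros_F card_power_eq)
qed (simp add: finite_power_eq)

lemma coords_surjective:
  assumes "frob 6 b = b" and "frob 1 c = c"
  obtains g where "g \<in> dual" "\<beta> g = b" "\<gamma> g = c"
proof -
  let ?targets = "{x :: 'a alg_closure. frob 6 x = x} \<times> {x :: 'a alg_closure. frob 1 x = x}"
  let ?coords = "\<lambda>g. (\<beta> g, \<gamma> g)"
  have "1 < q ^ 6"
    using q_gt_1 by (intro one_less_power) auto
  then have card: "finite ?targets" "card ?targets \<le> q ^ 6 * q"
    using q_gt_1 card_power_eq_self[of "q ^ 6"] card_power_eq_self[of q]
    unfolding card_cartesian_product frob_def
    by (auto intro!: mult_mono finite_power_eq_self)
  have "card {g \<in> dual. ?coords g = (b, c)} = q"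
  proof (rule card_fibre_eq_if_fibres_le)
    show "card {g \<in> dual. ?coords g = y} \<le> q" for y
    proof (cases "{g \<in> dual. ?coords g = y} = {}")
      case False
      then obtain g0 where g0: "g0 \<in> dual" "?coords g0 = y"
        by blast
      have "card {g \<in> dual. ?coords g = y} \<le> card multiples_F"
        using g0 by (intro card_inj_on_le[of "\<lambda>g. g - g0"])
          (auto simp: inj_on_def dual_diff \<beta>_diff \<gamma>_diff intro!: in_multiples_F_if_coords_eq_0)
      then show ?thesis
        using card_multiples_F_le by linarith
    qed (simp only: card.empty le0)
    have "q * card ?targets \<le> q * (q ^ 6 * q)"
      using card(2) by simp
    also have "\<dots> = card dual"
      by (simp add: card_dual flip: power_Suc power_Suc2)
    finally show "q * card ?targets \<le> card dual" .
  qed (use card frob_\<beta>(6) frob_\<gamma> assms in auto)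
  then have "{g \<in> dual. ?coords g = (b, c)} \<noteq> {}"
    using q_gt_1 by (metis card.empty not_one_less_zero)
  then show ?thesis
    using that by blast
qed

subsection \<open>The case \<open>q = 4\<close>\<close>

lemma CHAR_eq_2_if_q_eq_4:
  assumes "q = 4"
  shows "CHAR('a) = 2"
proof -
  obtain k where "k > 0" "q = CHAR('a) ^ k"
    using q_eq_CHAR_power by blast
  then have "CHAR('a) dvd 2 ^ 2"
    using assms dvd_power[of k "CHAR('a)"] by simp
  then show ?thesis
    using prime_CHAR by (metis prime_dvd_power primes_dvd_imp_eq two_is_prime_nat)
qed

context
  fixes \<zeta> :: "'a alg_closure"
  assumes q_eq_4: "q = 4" and \<zeta>_13: "\<zeta> ^ 13 = 1" and \<zeta>_neq_1: "\<zeta> \<noteq> 1"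
begin

lemma \<zeta>_power_mod: "\<zeta> ^ k = \<zeta> ^ (k mod 13)"
  using \<zeta>_13 by (rule power_eq_power_mod)

lemma add_self: "x + x = 0" and add_self_left: "x + (x + y) = y" for x y :: "'a alg_closure"
proof -
  have "- x = x"
    using CHAR_eq_2_if_q_eq_4[OF q_eq_4] by (intro uminus_CHAR_2) simp
  then show "x + x = 0"
    by (metis add.right_inverse)
  then show "x + (x + y) = y"
    by (simp flip: add.assoc)
qed

lemma frob_eq_power_4: "frob n x = x ^ 4 ^ n" for x :: "'a alg_closure"
  by (subst q_eq_4[symmetric]) (rule frob_def)

lemma frob_6_\<zeta>: "frob 6 \<zeta> = \<zeta>"
  using \<zeta>_power_mod[of 4096] by (simp add: frob_eq_power_4)

lemma trace6_\<zeta>_power: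
  "trace6 (\<zeta> ^ k) = \<zeta> ^ k + \<zeta> ^ (4 * k mod 13) + \<zeta> ^ (3 * k mod 13) + \<zeta> ^ (12 * k mod 13)
     + \<zeta> ^ (9 * k mod 13) + \<zeta> ^ (10 * k mod 13)"
proof -
  have "(\<zeta> ^ k) ^ n = (\<zeta> ^ k) ^ (n mod 13)" for n
    using \<zeta>_13 by (intro power_eq_power_mod) (metis mult.commute power_mult power_one)
  from this[of 16] this[of 64] this[of 256] this[of 1024] show ?thesis
    by (simp add: trace6_def frob_eq_power_4 mult.commute flip: power_mult \<zeta>_power_mod)
qed

lemma trace6_\<zeta>_power_mult_4: "trace6 (\<zeta> ^ (4 * k mod 13)) = trace6 (\<zeta> ^ k)"
proof -
  have "\<zeta> ^ (4 * k mod 13) = frob 1 (\<zeta> ^ k)"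
    by (simp add: frob_eq_power_4 mult.commute flip: \<zeta>_power_mod power_mult)
  moreover have "frob 6 (\<zeta> ^ k) = \<zeta> ^ k"
    by (simp add: frob_power frob_6_\<zeta>)
  ultimately show ?thesis
    by (simp add: trace6_frob_1)
qed

text \<open>The powers of 4 modulo 13 are the quadratic residues.\<close>

lemma trace6_\<zeta>_power_residue:
  assumes "k \<in> {1, 3, 4, 9, 10, 12}"
  shows "trace6 (\<zeta> ^ k) = trace6 \<zeta>"
  using assms trace6_\<zeta>_power_mult_4[of 1] trace6_\<zeta>_power_mult_4[of 4] trace6_\<zeta>_power_mult_4[of 3]
    trace6_\<zeta>_power_mult_4[of 12] trace6_\<zeta>_power_mult_4[of 9] by auto

lemma trace6_\<zeta>_power_nonresidue:
  assumes "k \<in> {2, 5, 6, 7, 8, 11}"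
  shows "trace6 (\<zeta> ^ k) = trace6 \<zeta> + 1"
proof -
  have "trace6 (\<zeta> ^ k) = trace6 (\<zeta> ^ 2)"
    using assms trace6_\<zeta>_power_mult_4[of 2] trace6_\<zeta>_power_mult_4[of 8] trace6_\<zeta>_power_mult_4[of 6]
      trace6_\<zeta>_power_mult_4[of 11] trace6_\<zeta>_power_mult_4[of 5] by auto
  also have "\<dots> = trace6 \<zeta> + 1"
  proof -
    have "(\<Sum>i<13. \<zeta> ^ i) = 0"
      using geometric_sum[OF \<zeta>_neq_1, of 13] \<zeta>_13 by simp
    also have "(\<Sum>i<13. \<zeta> ^ i) = (trace6 \<zeta> + 1) + trace6 (\<zeta> ^ 2)"
      using trace6_\<zeta>_power[of 1] trace6_\<zeta>_power[of 2] by (simp add: lessThan_nat_numeral)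
    finally show ?thesis
      using add_self_left[of "trace6 \<zeta> + 1" "trace6 (\<zeta> ^ 2)"] by simp
  qed
  finally show ?thesis .
qed

text \<open>The values of this functional at the zeros of \<open>F\<close> form a word of minimum weight 5 in the
  quadratic residue code of length 13 over the field of order 4.\<close>

lemma codeword_in_zeros:
  assumes g: "g \<in> dual" "\<beta> g = 1 + \<zeta> + \<zeta> ^ 2" "\<gamma> g = trace6 \<zeta> + 1"
    and j: "j \<in> {1, 2, 3, 5, 6, 8, 9, 10}" and P: "P \<in> zeros F" "z P = \<zeta> ^ j"
  shows "P \<in> zeros g"
proof -
  have "\<beta> g * z P = \<zeta> ^ j + \<zeta> ^ (j + 1) + \<zeta> ^ (j + 2)"
    by (simp add: g P(2) power_add power2_eq_square algebra_simps)
  then have "trace6 (\<beta> g * z P) = trace6 (\<zeta> ^ j) + trace6 (\<zeta> ^ (j + 1)) + trace6 (\<zeta> ^ (j + 2))"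
    by (simp only: trace6_add)
  also have "\<dots> = trace6 \<zeta> + 1"
    using j by (elim insertE emptyE)
      (simp_all add: trace6_\<zeta>_power_residue trace6_\<zeta>_power_nonresidue add_self add_self_left add_ac)
  finally have "\<gamma> g + trace6 (\<beta> g * z P) = 0"
    by (simp add: g add_self)
  then show ?thesis
    using to_ac_val_at_on_zeros_F[OF P(1) g(1)] by (simp add: zeros_def)
qed

lemma codeword_exists:
  obtains g where "g \<in> dual" "g \<notin> multiples_F" "\<beta> g = 1 + \<zeta> + \<zeta> ^ 2" "\<gamma> g = trace6 \<zeta> + 1"
proof -
  have "frob 6 (1 + \<zeta> + \<zeta> ^ 2) = 1 + \<zeta> + \<zeta> ^ 2"
    by (simp add: frob_add frob_power frob_6_\<zeta>)
  moreover have "frob 1 (trace6 \<zeta> + 1) = trace6 \<zeta> + 1"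
    by (simp add: frob_add frob_1_trace6 frob_6_\<zeta>)
  ultimately obtain g where g: "g \<in> dual" "\<beta> g = 1 + \<zeta> + \<zeta> ^ 2" "\<gamma> g = trace6 \<zeta> + 1"
    by (rule coords_surjective)
  have "(1 + \<zeta> + \<zeta> ^ 2) * (\<zeta> - 1) = \<zeta> ^ 3 - 1"
    by (simp add: algebra_simps power2_eq_square power3_eq_cube)
  moreover have "\<zeta> ^ 3 \<noteq> 1"
    using power_prime_root_eq_1_iff[OF _ \<zeta>_13 \<zeta>_neq_1, of 3] by simp
  ultimately have "\<beta> g \<noteq> 0"
    using g(2) by auto
  then have "g \<notin> multiples_F"
    using \<beta>_multiples_F by blast
  with g that show ?thesis
    by blast
qed

lemma eight_zeros_exist_4: "\<exists>g\<in>dual. g \<notin> multiples_F \<and> 8 \<le> card (zeros F \<inter> zeros g)"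
proof -
  let ?J = "{1, 2, 3, 5, 6, 8, 9, 10 :: nat}"
  obtain g where g: "g \<in> dual" "g \<notin> multiples_F" "\<beta> g = 1 + \<zeta> + \<zeta> ^ 2" "\<gamma> g = trace6 \<zeta> + 1"
    by (rule codeword_exists)
  have "(\<lambda>k. \<zeta> ^ k) ` ?J \<subseteq> z ` (zeros F \<inter> zeros g)"
  proof (rule image_subsetI)
    fix j assume j: "j \<in> ?J"
    have "(\<zeta> ^ j) ^ (q\<^sup>2 - q + 1) = 1"
      using \<zeta>_13 by (simp add: q_eq_4) (metis mult.commute power_mult power_one)
    then have "\<zeta> ^ j \<in> z ` zeros F"
      by (simp add: z_image_zeros_F)
    then obtain P where P: "P \<in> zeros F" "z P = \<zeta> ^ j"
      by (metis imageE)
    then show "\<zeta> ^ j \<in> z ` (zeros F \<inter> zeros g)"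
      using codeword_in_zeros[OF g(1,3,4) j P] by (intro image_eqI[of _ z P]) auto
  qed
  then have "card ((\<lambda>k. \<zeta> ^ k) ` ?J) \<le> card (zeros F \<inter> zeros g)"
    by (intro surj_card_le) simp_all
  moreover have "inj_on (\<lambda>k. \<zeta> ^ k) ?J"
    using inj_on_power_prime_root[OF _ \<zeta>_13 \<zeta>_neq_1] by (rule inj_on_subset) auto
  then have "card ((\<lambda>k. \<zeta> ^ k) ` ?J) = 8"
    by (simp only: card_image) simp
  ultimately show ?thesis
    using g(1,2) by auto
qed

end

lemma eight_zeros_exist:
  assumes "q \<ge> 4"
  shows "\<exists>g\<in>dual. g \<notin> multiples_F \<and> 8 \<le> card (zeros F \<inter> zeros g)"
proof (cases "q = 4")
  case True
  have "\<not> z ` zeros F \<subseteq> {1}"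
  proof
    assume "z ` zeros F \<subseteq> {1}"
    then have "card (z ` zeros F) \<le> card {1 :: 'a alg_closure}"
      by (intro card_mono) auto
    moreover have "card (z ` zeros F) = q\<^sup>2 - q + 1"
      by (simp add: card_image inj_on_subset[OF inj_z] card_zeros_F)
    ultimately show False
      using True by simp
  qed
  then obtain \<zeta> where "\<zeta> \<in> z ` zeros F" "\<zeta> \<noteq> 1"
    by blast
  then have "\<zeta> ^ (q\<^sup>2 - q + 1) = 1"
    using z_power_eq_1 by blast
  then have "\<zeta> ^ 13 = 1"
    by (simp add: True)
  then show ?thesis
    using eight_zeros_exist_4 True \<open>\<zeta> \<noteq> 1\<close> by blast
next
  case False
  then show ?thesis
    using eight_zeros_exist_large assms by simp
qed

end

subsection \<open>The points of \<open>O1\<close> in the hyperplane\<close>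

lemma pts_in_pts_in: "W \<subseteq> V \<Longrightarrow> pts_in (pts_in S V) W = pts_in S W"
  by (auto simp: pts_in_def)

context elliptic_functional
begin

lemma card_pts_in_hyperplane_subspace_le:
  assumes "W \<subseteq> hyperplane F" and "fq_subspace_dim q W 5"
  shows "card (pts_in (O1 q) W) \<le> 6"
proof -
  have "q ^ 3 \<le> card (annihilator W)"
    using card_annihilator_subspace[OF order.trans[OF assms(1) hyperplane_subset_U1] assms(2)]
    by simp
  then obtain g h where gh: "g \<in> annihilator W" "h \<in> annihilator W" "independent_mod_F g h"
    using independent_mod_F_exists[OF annihilator_subset_dual] by blast
  then have "{P. ovoid_vec P \<in> W} \<subseteq> zeros F \<inter> zeros g \<inter> zeros h"
    using assms(1) ovoid_vec_in_hyperplane_iff[of _ F] in_zeros_if_annihilator by blast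
  then have "card {P. ovoid_vec P \<in> W} \<le> card (zeros F \<inter> zeros g \<inter> zeros h)"
    by (intro card_mono) auto
  also have "\<dots> \<le> 6"
    using gh annihilator_subset_dual by (intro card_common_zeros_le) auto
  finally show ?thesis
    using assms(2) by (simp add: card_pts_in_O1 fq_subspace_dim_iff)
qed

lemma pts_in_hyperplane_span:
  assumes "q \<ge> 4" and card_hyperplane: "card (hyperplane F) = q ^ 7"
  obtains vs where "set vs \<subseteq> \<Union>(pts_in (O1 q) (hyperplane F))" "fq_span q vs = hyperplane F"
proof -
  let ?S = "\<Union>(pts_in (O1 q) (hyperplane F))"
  have S: "?S \<subseteq> hyperplane F"
    by (auto simp: pts_in_def)
  have finite_hyperplane: "finite (hyperplane F)"
    using finite_subset[OF hyperplane_subset_U1 finite_U1] .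
  obtain vs where vs: "set vs \<subseteq> ?S" "fq_indep q vs" "?S \<subseteq> fq_span q vs"
    using fq_basis_exists finite_subset[OF S finite_hyperplane] by metis
  have subset: "fq_span q vs \<subseteq> hyperplane F"
    using fq_subspace_hyperplane vs(1) S by (intro fq_span_subset) auto
  have "ovoid_vec P \<in> fq_span q vs" if "P \<in> zeros F" for P
    using that vs(3) ovoid_vec_in_ovoid_point[of P]
    by (auto simp: pts_in_O1 fq_subspace_hyperplane ovoid_vec_in_hyperplane_iff)
  then have "annihilator (set vs) \<subseteq> multiples_F"
    using annihilator_zeros_F_subset_multiples_F[OF \<open>q \<ge> 4\<close>] by (metis annihilator_fq_span)
  then have "card (annihilator (set vs)) \<le> q"
    using card_multiples_F_le card_mono[of multiples_F "annihilator (set vs)"] by simp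
  moreover have "q < q\<^sup>2"
    using q_gt_1 by (simp add: power2_eq_square)
  moreover have "set vs \<subseteq> U1 q"
    using vs(1) S hyperplane_subset_U1 by blast
  ultimately have "\<not> length vs \<le> 6"
    using card_annihilator_ge[of vs 6] by auto
  then have "card (hyperplane F) \<le> card (fq_span q vs)"
    using card_fq_span[OF vs(2)] q_gt_1 by (simp add: card_hyperplane card_Fq power_increasing)
  then have "fq_span q vs = hyperplane F"
    using finite_hyperplane subset by (intro card_seteq)
  with vs(1) that show ?thesis
    by blast
qed

lemma eight_pts_in_subspace_exist:
  assumes "q \<ge> 4" and card_hyperplane: "card (hyperplane F) = q ^ 7"
  obtains W where "W \<subseteq> hyperplane F" "fq_subspace_dim q W 6" "8 \<le> card (pts_in (O1 q) W)"
proof -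
  obtain g where g: "g \<in> dual" "g \<notin> multiples_F" "8 \<le> card (zeros F \<inter> zeros g)"
    using eight_zeros_exist[OF \<open>q \<ge> 4\<close>] by blast
  define W where "W = hyperplane F \<inter> hyperplane g"
  have params_W: "{P. ovoid_vec P \<in> W} = zeros F \<inter> zeros g"
    by (auto simp: W_def ovoid_vec_in_hyperplane_iff)
  obtain P where "P \<in> zeros F" "P \<notin> zeros g"
    using in_multiples_F_if_vanishing_on_zeros \<open>q \<ge> 4\<close> g by blast
  then have "\<not> hyperplane F \<subseteq> hyperplane g"
    using ovoid_vec_in_hyperplane_iff by blast
  then have "card W * q = q ^ 7"
    using card_Int_hyperplane[OF fq_subspace_hyperplane[of F] hyperplane_subset_U1 g(1)]
    by (simp add: W_def card_hyperplane)
  also have "\<dots> = q ^ 6 * q"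
    by (simp flip: power_Suc2)
  finally have "card W = q ^ 6"
    using q_gt_1 by simp
  moreover have W: "fq_subspace W" "finite W"
    using fq_subspace_Int[OF fq_subspace_hyperplane fq_subspace_hyperplane]
      finite_subset[OF hyperplane_subset_U1 finite_U1] by (simp_all add: W_def)
  ultimately have "fq_subspace_dim q W 6"
    by (simp add: fq_subspace_dim_iff card_Fq)
  moreover have "8 \<le> card (pts_in (O1 q) W)"
    using g(3) by (simp add: card_pts_in_O1 W params_W)
  moreover have "W \<subseteq> hyperplane F"
    by (simp add: W_def)
  ultimately show ?thesis
    using that by blast
qed

lemma rs_set_pts_in_hyperplane:
  assumes "q \<ge> 4" and "card (hyperplane F) = q ^ 7"
  shows "rs_set q 6 4 (hyperplane F) (pts_in (O1 q) (hyperplane F))"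
  unfolding rs_set_def
proof (intro conjI allI impI)
  show "card (pts_in (pts_in (O1 q) (hyperplane F)) W) \<le> 6"
    if "W \<subseteq> hyperplane F \<and> fq_subspace_dim q W (4 + 1)" for W
    using that by (simp add: pts_in_pts_in card_pts_in_hyperplane_subspace_le)
  show "\<exists>vs. set vs \<subseteq> \<Union>(pts_in (O1 q) (hyperplane F)) \<and> fq_span q vs = hyperplane F"
    by (rule pts_in_hyperplane_span[OF assms]) blast
  show "\<exists>W\<subseteq>hyperplane F. fq_subspace_dim q W (4 + 2)
      \<and> 6 + 2 \<le> card (pts_in (pts_in (O1 q) (hyperplane F)) W)"
    by (rule eight_pts_in_subspace_exist[OF assms]) (auto simp: pts_in_pts_in)
qed

end

theorem mainTheorem11:
  fixes q :: nat and H1 :: "(nat \<Rightarrow> 'a::{finite,field}) set"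
  assumes "\<exists>p k. prime p \<and> k > 0 \<and> q = p ^ k"
    and "card (UNIV :: 'a set) = q ^ 3"
    and "q \<ge> 4"
    and "H1 \<subseteq> U1 q" and "fq_subspace_dim q H1 7"
    and "card (pts_in (O1 q) H1) = q^2 - q + 1"
  shows "rs_set q 6 4 H1 (pts_in (O1 q) H1)"
proof -
  interpret cubic_extension q "TYPE('a)"
    using assms(1,2) by (rule cubic_extension_if_prime_power)
  obtain F where F: "F \<in> dual" "H1 = hyperplane F"
    using subspace_dim_7_eq_hyperplane[OF assms(4,5)] by metis
  have "card (zeros F) = q\<^sup>2 - q + 1"
    using assms(6)
    by (simp add: F(2) card_pts_in_O1 fq_subspace_hyperplane ovoid_vec_in_hyperplane_iff)
  then obtain \<theta> base where "elliptic_functional q F \<theta> base"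
    using elliptic_functional_exists F(1) by blast
  then interpret elliptic_functional q "TYPE('a)" F \<theta> base .
  have "card (hyperplane F) = q ^ 7"
    using assms(5) by (simp add: F(2) fq_subspace_dim_iff card_Fq)
  then show ?thesis
    unfolding F(2) by (rule rs_set_pts_in_hyperplane[OF assms(3)])
qed

end
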